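(* Let $\beta\in\{1,2,4\}$, let $1\le N_0\le N-1$ be integers, and let $0<b_2\le b_1$. Let $X_1,X_2,\dots$ be independent copies of the random $N\times N$ matrix $X=\Sigma^{1/2}G$, where $\Sigma={\rm diag}[\sigma_1^2,\dots,\sigma_N^2]$ with $$\frac1{2\sigma_1^2}=\cdots=\frac1{2\sigma_{N_0}^2}=b_1,\qquad \frac1{2\sigma_{N_0+1}^2}=\cdots=\frac1{2\sigma_N^2}=b_2,$$ and $G$ has independent real ($\beta=1$), complex ($\beta=2$) or quaternion ($\beta=4$) entries whose $\beta$ real components are independent standard normal random variables. Then the largest Lyapunov exponent $\mu_1$ of the product $P_m=X_mX_{m-1}\cdots X_1$ is $$\mu_1=\frac12\bigg(\Psi(\beta N/2)-\log b_2+\frac{\Gamma(\beta N/2)}{\Gamma(\beta N_0/2)\Gamma(\beta(N-N_0)/2)}\int_0^1x^{\beta N_0/2-1}(1-x)^{\beta(N-N_0)/2-1}\log\Big(1-\Big(1-\frac{b_2}{b_1}\Big)x\Big)\,dx\bigg).$$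
   Context: $\Psi(x)=\frac{d}{dx}\log\Gamma(x)$ is the digamma function. The largest Lyapunov exponent is the almost surely constant quantity $$\mu_1=\sup_{y\ne0}\ \lim_{m\to\infty}\frac1m\log\|P_my\|,$$ the supremum being over nonzero column vectors $y$ with entries in the corresponding number system ($\mathbb R$, $\mathbb C$ or the quaternions) and $\|\cdot\|$ the Euclidean norm ($\|y\|^2$ is the sum of the squares of all real components of $y$). Equivalently, by Oseledec's theorem, $e^{\mu_1}$ is the largest eigenvalue of $\lim_{m\to\infty}(P_m^\dagger P_m)^{1/2m}$. *)

theory Defs
  imports "HOL-Probability.Probability"
begin

codatatype quat = Quat (Re1: real) (Im_i: real) (Im_j: real) (Im_k: real)

lemma quat_eq_iff:
  "x = y \<longleftrightarrow> Re1 x = Re1 y \<and> Im_i x = Im_i y \<and> Im_j x = Im_j y \<and> Im_k x = Im_k y"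
  by (auto intro: quat.expand)

instantiation quat :: ring_1
begin

primcorec zero_quat :: quat where
  "Re1 0 = 0" | "Im_i 0 = 0" | "Im_j 0 = 0" | "Im_k 0 = 0"

primcorec one_quat :: quat where
  "Re1 1 = 1" | "Im_i 1 = 0" | "Im_j 1 = 0" | "Im_k 1 = 0"

primcorec plus_quat :: "quat \<Rightarrow> quat \<Rightarrow> quat" where
  "Re1 (x + y) = Re1 x + Re1 y"
| "Im_i (x + y) = Im_i x + Im_i y"
| "Im_j (x + y) = Im_j x + Im_j y"
| "Im_k (x + y) = Im_k x + Im_k y"

primcorec uminus_quat :: "quat \<Rightarrow> quat" where
  "Re1 (- x) = - Re1 x"
| "Im_i (- x) = - Im_i x"
| "Im_j (- x) = - Im_j x"
| "Im_k (- x) = - Im_k x"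

primcorec minus_quat :: "quat \<Rightarrow> quat \<Rightarrow> quat" where
  "Re1 (x - y) = Re1 x - Re1 y"
| "Im_i (x - y) = Im_i x - Im_i y"
| "Im_j (x - y) = Im_j x - Im_j y"
| "Im_k (x - y) = Im_k x - Im_k y"

primcorec times_quat :: "quat \<Rightarrow> quat \<Rightarrow> quat" where
  "Re1 (x * y) = Re1 x * Re1 y - Im_i x * Im_i y - Im_j x * Im_j y - Im_k x * Im_k y"
| "Im_i (x * y) = Re1 x * Im_i y + Im_i x * Re1 y + Im_j x * Im_k y - Im_k x * Im_j y"
| "Im_j (x * y) = Re1 x * Im_j y - Im_i x * Im_k y + Im_j x * Re1 y + Im_k x * Im_i y"
| "Im_k (x * y) = Re1 x * Im_k y + Im_i x * Im_j y - Im_j x * Im_i y + Im_k x * Re1 y"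

instance
  by standard (simp_all add: quat_eq_iff algebra_simps)

end

instantiation quat :: real_algebra_1
begin

primcorec scaleR_quat :: "real \<Rightarrow> quat \<Rightarrow> quat" where
  "Re1 (scaleR r x) = r * Re1 x"
| "Im_i (scaleR r x) = r * Im_i x"
| "Im_j (scaleR r x) = r * Im_j x"
| "Im_k (scaleR r x) = r * Im_k x"

instance
  by standard (simp_all add: quat_eq_iff algebra_simps)

end

instantiation quat :: real_inner
begin

definition inner_quat :: "quat \<Rightarrow> quat \<Rightarrow> real" where
  "inner x y = Re1 x * Re1 y + Im_i x * Im_i y + Im_j x * Im_j y + Im_k x * Im_k y"

definition norm_quat :: "quat \<Rightarrow> real" where
  "norm x = sqrt (inner x (x :: quat))"

definition sgn_quat :: "quat \<Rightarrow> quat" where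
  "sgn x = (x :: quat) /\<^sub>R norm x"

definition dist_quat :: "quat \<Rightarrow> quat \<Rightarrow> real" where
  "dist x y = norm (x - y :: quat)"

definition uniformity_quat :: "(quat \<times> quat) filter" where
  "uniformity_quat = (INF e\<in>{0<..}. principal {(x, y). dist x y < e})"

definition open_quat :: "quat set \<Rightarrow> bool" where
  "open_quat U \<longleftrightarrow> (\<forall>x\<in>U. eventually (\<lambda>(x', y). x' = x \<longrightarrow> y \<in> U) uniformity)"

instance
proof
  fix x y z :: quat and r :: real and U :: "quat set"
  show "dist x y = norm (x - y)"
    by (rule dist_quat_def)
  show "sgn x = x /\<^sub>R norm x"
    by (rule sgn_quat_def)
  show "uniformity = (INF e\<in>{0<..}. principal {(x :: quat, y). dist x y < e})"
    by (rule uniformity_quat_def)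
  show "open U \<longleftrightarrow> (\<forall>x\<in>U. eventually (\<lambda>(x', y). x' = x \<longrightarrow> y \<in> U) uniformity)"
    by (rule open_quat_def)
  show "inner x y = inner y x"
    by (simp add: inner_quat_def algebra_simps)
  show "inner (x + y) z = inner x z + inner y z"
    by (simp add: inner_quat_def algebra_simps)
  show "inner (scaleR r x) y = r * inner x y"
    by (simp add: inner_quat_def algebra_simps)
  show "0 \<le> inner x x"
    by (simp add: inner_quat_def)
  show "inner x x = 0 \<longleftrightarrow> x = 0"
    by (simp add: inner_quat_def quat_eq_iff add_nonneg_eq_0_iff)
  show "norm x = sqrt (inner x (x :: quat))"
    by (rule norm_quat_def)
qed

end

instantiation quat :: inverse
begin

definition inverse_quat :: "quat \<Rightarrow> quat" where
  "inverse (x :: quat) = (2 * Re1 x / inner x x) *\<^sub>R 1 - x /\<^sub>R inner x x"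

definition divide_quat :: "quat \<Rightarrow> quat \<Rightarrow> quat" where
  "x div y = x * inverse y" for x y :: quat

instance ..

end

lemma quat_conj_mult:
  "((2 * Re1 x) *\<^sub>R 1 - x) * x = inner x x *\<^sub>R (1 :: quat)"
  "x * ((2 * Re1 x) *\<^sub>R 1 - x) = inner x x *\<^sub>R (1 :: quat)"
  by (simp_all add: quat_eq_iff inner_quat_def algebra_simps)

lemma inverse_quat_altdef:
  "inverse x = ((2 * Re1 x) *\<^sub>R 1 - x) /\<^sub>R inner x (x :: quat)"
  by (simp add: inverse_quat_def quat_eq_iff divide_inverse algebra_simps)

instance quat :: real_normed_div_algebra
proof
  fix x y :: quat
  show "x \<noteq> 0 \<Longrightarrow> inverse x * x = 1"
    unfolding inverse_quat_altdef by (simp add: quat_conj_mult del: times_quat.simps)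
  show "x \<noteq> 0 \<Longrightarrow> x * inverse x = 1"
    unfolding inverse_quat_altdef by (simp add: quat_conj_mult del: times_quat.simps)
  show "x / y = x * inverse y"
    by (rule divide_quat_def)
  show "inverse (0 :: quat) = 0"
    by (simp add: inverse_quat_def)
  have "inner (x * y) (x * y) = inner x x * inner y y"
    by (simp add: inner_quat_def) algebra
  then show "norm (x * y) = norm x * norm y"
    by (simp add: norm_quat_def real_sqrt_mult)
qed

instantiation quat :: euclidean_space
begin

definition Basis_quat :: "quat set" where
  "Basis = {Quat 1 0 0 0, Quat 0 1 0 0, Quat 0 0 1 0, Quat 0 0 0 1}"

instance
proof
  fix u v x :: quat
  show "Basis \<noteq> ({} :: quat set)" "finite (Basis :: quat set)"
    by (simp_all add: Basis_quat_def)
  show "inner u v = (if u = v then 1 else 0)" if "u \<in> Basis" "v \<in> Basis"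
    using that unfolding Basis_quat_def by (elim insertE emptyE) (simp_all add: inner_quat_def)
  show "(\<forall>u\<in>Basis. inner x u = 0) \<longleftrightarrow> x = 0"
    by (simp add: Basis_quat_def inner_quat_def quat_eq_iff[of x 0])
qed

end

lemma DIM_quat [simp]: "DIM(quat) = 4"
  by (simp add: Basis_quat_def)

definition diag_mat :: "('n \<Rightarrow> real) \<Rightarrow> 'a::real_algebra_1 ^ 'n ^ 'n" where
  "diag_mat d = (\<chi> i j. if i = j then of_real (d i) else 0)"

text \<open>The real components of an entry are its coordinates with respect to \<^const>\<open>Basis\<close>, which is
  \<open>{1}\<close> for \<^typ>\<open>real\<close>, \<open>{1, \<i>}\<close> for \<^typ>\<open>complex\<close> and the four standard units for \<^typ>\<open>quat\<close>.\<close>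

definition std_gaussian_matrix :: "'w measure \<Rightarrow> ('w \<Rightarrow> 'a::euclidean_space ^ 'n ^ 'm) \<Rightarrow> bool" where
  "std_gaussian_matrix M G \<longleftrightarrow>
     prob_space.indep_vars M (\<lambda>_. borel) (\<lambda>(i, j, b) \<omega>. inner (G \<omega> $ i $ j) b) (UNIV \<times> UNIV \<times> Basis) \<and>
     (\<forall>i j. \<forall>b\<in>Basis. distributed M lborel (\<lambda>\<omega>. inner (G \<omega> $ i $ j) b) std_normal_density)"

definition iid_copies ::
    "'w measure \<Rightarrow> (nat \<Rightarrow> 'w \<Rightarrow> 'b::topological_space) \<Rightarrow> 'v measure \<Rightarrow> ('v \<Rightarrow> 'b) \<Rightarrow> bool" where
  "iid_copies M X M' Y \<longleftrightarrow>
     prob_space.indep_vars M (\<lambda>_. borel) X {1..} \<and>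
     (\<forall>m\<ge>1. distr M borel (X m) = distr M' borel Y)"

primrec mat_prod :: "(nat \<Rightarrow> 'a::semiring_1 ^ 'n ^ 'n) \<Rightarrow> nat \<Rightarrow> 'a ^ 'n ^ 'n" where
  "mat_prod A 0 = mat 1"
| "mat_prod A (Suc m) = A (Suc m) ** mat_prod A m"

text \<open>The vanishing case is separated because \<open>ln 0 = 0\<close> over the reals.\<close>

definition growth_rate ::
    "(nat \<Rightarrow> 'a::real_normed_algebra_1 ^ 'n ^ 'n) \<Rightarrow> 'a ^ 'n \<Rightarrow> nat \<Rightarrow> ereal" where
  "growth_rate A y m =
     (if mat_prod A m *v y = 0 then -\<infinity> else ereal (1 / real m * ln (norm (mat_prod A m *v y))))"

definition largest_lyapunov_exponent :: "(nat \<Rightarrow> 'a::real_normed_algebra_1 ^ 'n ^ 'n) \<Rightarrow> ereal" where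
  "largest_lyapunov_exponent A = Sup {l. \<exists>y. y \<noteq> 0 \<and> growth_rate A y \<longlonglongrightarrow> l}"

text \<open>For a random sequence of matrices the exponent is an almost surely constant quantity. Since
  \<^const>\<open>largest_lyapunov_exponent\<close> only takes existing limits into account, the almost sure
  existence of the limit is required for every fixed nonzero vector as well.\<close>

definition has_largest_lyapunov_exponent ::
    "'w measure \<Rightarrow> (nat \<Rightarrow> 'w \<Rightarrow> 'a::real_normed_algebra_1 ^ 'n ^ 'n) \<Rightarrow> real \<Rightarrow> bool" where
  "has_largest_lyapunov_exponent M X \<mu> \<longleftrightarrow>
     (\<forall>y. y \<noteq> 0 \<longrightarrow> (AE \<omega> in M. convergent (growth_rate (\<lambda>m. X m \<omega>) y))) \<and>
     (AE \<omega> in M. largest_lyapunov_exponent (\<lambda>m. X m \<omega>) = ereal \<mu>)"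

end

theory Submission
  imports Defs
begin

text \<open>
  By isotropy of the Gaussian entries, \<open>\<parallel>X v\<parallel>\<close> has the law of \<open>\<parallel>v\<parallel>\<close> times \<open>sqrt (A\<^sub>1 / b\<^sub>1 + A\<^sub>2 / b\<^sub>2)\<close> with
  independent Gamma variables \<open>A\<^sub>1\<close>, \<open>A\<^sub>2\<close> of parameters \<open>\<beta> N\<^sub>0 / 2\<close> and \<open>\<beta> (N - N\<^sub>0) / 2\<close>, for every fixed \<open>v\<close>.
  Hence \<open>E \<parallel>P\<^sub>m y\<parallel>\<^sup>t = \<kappa>(t)\<^sup>m \<parallel>y\<parallel>\<^sup>t\<close> for small \<open>t\<close> of either sign, and Markov's inequality with
  Borel-Cantelli gives \<open>ln \<parallel>P\<^sub>m y\<parallel> / m \<longlonglongrightarrow> \<kappa>'(0)\<close> almost surely; no law of large numbers is needed.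
  The total \<open>A\<^sub>1 + A\<^sub>2\<close> and the proportion \<open>A\<^sub>1 / (A\<^sub>1 + A\<^sub>2)\<close> are independent with Gamma and Beta laws, so
  \<open>\<kappa>\<close> factors and its derivative at \<open>0\<close> is the Digamma term plus the Beta integral. The exceptional
  null sets depend on \<open>y\<close>, but every vector is controlled by the finitely many basis vectors.
\<close>

section \<open>Gamma and Beta laws\<close>

text \<open>A positive exponent bounds the probability that the product is too large, a negative one
  that it is too small, so a single moment identity serves both tails. For this it is enough to have
  an upper bound \<open>U\<close> of \<open>\<kappa>\<close> near 0 with \<open>U 0 = 1\<close> and
  slope \<open>l\<close> at 0. The Beta factor is therefore estimated by an elementary quadratic
  inequality instead of being differentiated under the integral sign.

  The noncommutativity of the quaternions shapes the use of isotropy. In place of invariance under a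
  full unitary group, each entry is treated alone: right multiplication by a unit scalar is a
  real-linear isometry of the algebra. This replaces the vector by the real vector of the norms of
  its entries, and real combinations do not mix the real coordinates of the algebra. The argument
  then runs over any finite-dimensional real normed division algebra, and \<beta> enters only as its
  real dimension.\<close>

definition gamma_density :: "real \<Rightarrow> real \<Rightarrow> real" where
  "gamma_density a x = indicator {0<..} x * x powr (a - 1) * exp (- x) / Gamma a"

definition beta_density :: "real \<Rightarrow> real \<Rightarrow> real \<Rightarrow> real" where
  "beta_density a b u = indicator {0<..<1} u * u powr (a - 1) * (1 - u) powr (b - 1) / Beta a b"

lemma gamma_density_measurable [measurable]: "gamma_density a \<in> borel_measurable borel"
  unfolding gamma_density_def[abs_def] by measurable

lemma beta_density_measurable [measurable]: "beta_density a b \<in> borel_measurable borel"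
  unfolding beta_density_def[abs_def] by measurable

lemma gamma_density_nonneg: "0 < a \<Longrightarrow> 0 \<le> gamma_density a x"
  unfolding gamma_density_def by (auto simp: indicator_def)

lemma Beta_real_pos: "0 < a \<Longrightarrow> 0 < b \<Longrightarrow> 0 < Beta a (b::real)"
  unfolding Beta_def by simp

lemma beta_density_nonneg: "0 < a \<Longrightarrow> 0 < b \<Longrightarrow> 0 \<le> beta_density a b x"
  unfolding beta_density_def by (auto simp: indicator_def less_imp_le[OF Beta_real_pos])

lemma nn_integral_gamma_density_powr:
  assumes a: "0 < a" and at: "0 < a + t"
  shows "(\<integral>\<^sup>+x. ennreal (gamma_density a x * x powr t) \<partial>lborel) = ennreal (Gamma (a + t) / Gamma a)"
proof -
  have "(\<integral>\<^sup>+x. ennreal (gamma_density a x * x powr t) \<partial>lborel) =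
      (\<integral>\<^sup>+x. ennreal (1 / Gamma a) * ennreal (indicator {0..} x * x powr (a + t - 1) / exp x) \<partial>lborel)"
  proof (rule nn_integral_cong)
    fix x :: real
    have "gamma_density a x * x powr t = 1 / Gamma a * (indicator {0..} x * x powr (a + t - 1) / exp x)"
    proof (cases "x > 0")
      case True
      have "a + t - 1 = (a - 1) + t" by simp
      then have "x powr (a + t - 1) = x powr ((a - 1) + t)" by (rule arg_cong)
      also have "\<dots> = x powr (a - 1) * x powr t" by (rule powr_add)
      finally show ?thesis using True by (simp add: gamma_density_def exp_minus divide_inverse)
    qed (auto simp: gamma_density_def indicator_def)
    then show "ennreal (gamma_density a x * x powr t) = ennreal (1 / Gamma a) * ennreal (indicator {0..} x * x powr (a + t - 1) / exp x)"
      using a by (subst ennreal_mult'[symmetric]) auto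
  qed
  also have "\<dots> = ennreal (1 / Gamma a) * ennreal (Gamma (a + t))"
    using at by (subst nn_integral_cmult) (auto simp: Gamma_conv_nn_integral_real)
  also have "\<dots> = ennreal (Gamma (a + t) / Gamma a)"
    using a at by (subst ennreal_mult[symmetric]) auto
  finally show ?thesis .
qed

lemma beta_density_integral:
  assumes "0 < a" "0 < b"
  shows "integrable lborel (beta_density a b)" "(\<integral>x. beta_density a b x \<partial>lborel) = 1"
    "(\<integral>\<^sup>+x. ennreal (beta_density a b x) \<partial>lborel) = 1"
proof -
  have e: "beta_density a b x = 1 / Beta a b * (indicator {0..1} x *\<^sub>R (x powr (a - 1) * (1 - x) powr (b - 1)))" for x
    by (auto simp: beta_density_def indicator_def)
  have i: "integrable lborel (\<lambda>x. indicator {0..1} x *\<^sub>R (x powr (a - 1) * (1 - x) powr (b - 1)))"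
    using integrable_Beta[OF assms] by (simp add: set_integrable_def)
  show 1: "integrable lborel (beta_density a b)"
    unfolding e[abs_def] by (intro integrable_mult_right i)
  have "(\<integral>x. indicator {0..1} x *\<^sub>R (x powr (a - 1) * (1 - x) powr (b - 1)) \<partial>lborel) = Beta a b"
    using set_borel_integral_eq_integral(2)[OF integrable_Beta[OF assms]]
      integral_unique[OF has_integral_Beta_real[OF assms]]
    by (simp add: set_lebesgue_integral_def)
  then show 2: "(\<integral>x. beta_density a b x \<partial>lborel) = 1"
    unfolding e[abs_def] using Beta_real_pos[OF assms] by simp
  show "(\<integral>\<^sup>+x. ennreal (beta_density a b x) \<partial>lborel) = 1"
    using nn_integral_eq_integral[OF 1] beta_density_nonneg[OF assms] 2 by simp
qed

text \<open>The leading \<open>s\<close> is the Jacobian of \<open>x = s * u\<close> at fixed total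
  \<open>s\<close>. It supplies the power missing in
  \<open>(a - 1) + (b - 1) = (a + b - 1) - 1\<close>, and
  \<open>Gamma a * Gamma b = Beta a b * Gamma (a + b)\<close> separates the normalising
  constants.\<close>

lemma gamma_density_prod:
  assumes "0 < a" "0 < b" "0 < s"
  shows "s * (gamma_density a (s * u) * gamma_density b (s - s * u)) = beta_density a b u * gamma_density (a + b) s"
proof -
  consider "u \<le> 0" | "u \<ge> 1" | "0 < u" "u < 1" by linarith
  then show ?thesis
  proof cases
    case 1 then show ?thesis using assms
      by (simp add: gamma_density_def beta_density_def indicator_def zero_less_mult_iff)
  next
    case 2 then have "s - s * u \<le> 0" using assms by simp
    with 2 show ?thesis using assms
      by (simp add: gamma_density_def beta_density_def indicator_def)
  next
    case 3
    have e: "s - s * u = s * (1 - u)" by (simp add: algebra_simps)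
    have p: "0 < s * (1 - u)" using 3 assms by simp
    have s: "s powr (a + b - 1) = s * (s powr (a - 1) * s powr (b - 1))"
    proof -
      have "a + b - 1 = 1 + ((a - 1) + (b - 1))" by simp
      then have "s powr (a + b - 1) = s powr (1 + ((a - 1) + (b - 1)))" by (rule arg_cong)
      also have "\<dots> = s * (s powr (a - 1) * s powr (b - 1))"
        using assms unfolding powr_add by simp
      finally show ?thesis .
    qed
    have x: "exp (- s) = exp (- (s * u)) * exp (- (s * (1 - u)))"
      by (simp add: exp_add[symmetric] algebra_simps)
    have B: "Gamma a * Gamma b = Beta a b * Gamma (a + b)" "Beta a b > 0" "Gamma (a + b) > 0" "Gamma a > 0" "Gamma b > 0"
      using assms Gamma_real_pos[of "a + b"] Beta_real_pos[of a b] unfolding Beta_def by (simp_all add: less_le)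
    have "s * (gamma_density a (s * u) * gamma_density b (s - s * u)) =
      s * (s powr (a-1) * u powr (a-1) * exp (- (s * u)) * (s powr (b-1) * (1-u) powr (b-1) * exp (- (s * (1 - u))))) / (Gamma a * Gamma b)"
      unfolding e gamma_density_def using 3 assms p by (simp add: powr_mult)
    also have "\<dots> = (u powr (a-1) * (1-u) powr (b-1) / Beta a b) * (s powr (a + b - 1) * exp (- s) / Gamma (a + b))"
      unfolding s x B(1) by (simp only: times_divide_times_eq mult_ac)
    also have "\<dots> = beta_density a b u * gamma_density (a + b) s"
      using 3 assms by (simp add: gamma_density_def beta_density_def)
    finally show ?thesis .
  qed
qed

text \<open>In the new variables, the total \<open>s\<close> is again Gamma distributed and independent of the Beta distributed proportion \<open>u\<close>.\<close>

lemma nn_integral_gamma_density_pair: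
  fixes F :: "real \<times> real \<Rightarrow> ennreal"
  assumes [simp]: "0 < a" "0 < b" and [measurable]: "F \<in> borel_measurable borel"
  shows "(\<integral>\<^sup>+x. \<integral>\<^sup>+y. F (x, y) * ennreal (gamma_density a x) * ennreal (gamma_density b y) \<partial>lborel \<partial>lborel) =
    (\<integral>\<^sup>+s. \<integral>\<^sup>+u. F (s * u, s * (1 - u)) * ennreal (beta_density a b u) * ennreal (gamma_density (a + b) s) \<partial>lborel \<partial>lborel)"
proof -
  have [measurable]: "F \<in> borel_measurable (borel \<Otimes>\<^sub>M borel)" by (simp add: borel_prod)
  \<comment> \<open>The planar change of variables is done as two affine ones on the line:
    \<open>y = s - x\<close> at fixed \<open>x\<close>, then, after exchanging the integrals,
    \<open>x = s * u\<close> at fixed \<open>s\<close>.\<close>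
  have "(\<integral>\<^sup>+x. \<integral>\<^sup>+y. F (x, y) * ennreal (gamma_density a x) * ennreal (gamma_density b y) \<partial>lborel \<partial>lborel) =
     (\<integral>\<^sup>+x. \<integral>\<^sup>+s. F (x, s - x) * ennreal (gamma_density a x) * ennreal (gamma_density b (s - x)) \<partial>lborel \<partial>lborel)"
  proof (rule nn_integral_cong)
    fix x
    show "(\<integral>\<^sup>+y. F (x, y) * ennreal (gamma_density a x) * ennreal (gamma_density b y) \<partial>lborel) =
      (\<integral>\<^sup>+s. F (x, s - x) * ennreal (gamma_density a x) * ennreal (gamma_density b (s - x)) \<partial>lborel)"
      by (subst nn_integral_real_affine[where c=1 and t="-x"]) auto
  qed
  also have "\<dots> = (\<integral>\<^sup>+s. \<integral>\<^sup>+x. F (x, s - x) * ennreal (gamma_density a x) * ennreal (gamma_density b (s - x)) \<partial>lborel \<partial>lborel)"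
    by (rule lborel_pair.Fubini') measurable
  also have "\<dots> = (\<integral>\<^sup>+s. \<integral>\<^sup>+u. F (s * u, s * (1 - u)) * ennreal (beta_density a b u) * ennreal (gamma_density (a + b) s) \<partial>lborel \<partial>lborel)"
  proof (rule nn_integral_cong)
    fix s :: real
    show "(\<integral>\<^sup>+x. F (x, s - x) * ennreal (gamma_density a x) * ennreal (gamma_density b (s - x)) \<partial>lborel) =
       (\<integral>\<^sup>+u. F (s * u, s * (1 - u)) * ennreal (beta_density a b u) * ennreal (gamma_density (a + b) s) \<partial>lborel)"
    proof (cases "s > 0")
      case False
      have "gamma_density a x * gamma_density b (s - x) = 0" for x
        using False by (auto simp: gamma_density_def indicator_def)
      then have "F (x, s - x) * ennreal (gamma_density a x) * ennreal (gamma_density b (s - x)) = 0" for x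
        by (metis ennreal_0 mult_eq_0_iff mult_zero_right)
      moreover have "gamma_density (a + b) s = 0" using False by (simp add: gamma_density_def)
      ultimately show ?thesis by (simp only: ennreal_0 mult_zero_right)
    next
      case True
      have "(\<integral>\<^sup>+x. F (x, s - x) * ennreal (gamma_density a x) * ennreal (gamma_density b (s - x)) \<partial>lborel) =
        ennreal s * (\<integral>\<^sup>+u. F (s * u, s - s * u) * ennreal (gamma_density a (s * u)) * ennreal (gamma_density b (s - s * u)) \<partial>lborel)"
        using True by (subst nn_integral_real_affine[where c=s and t=0]) auto
      also have "\<dots> = (\<integral>\<^sup>+u. ennreal s * (F (s * u, s - s * u) * ennreal (gamma_density a (s * u)) * ennreal (gamma_density b (s - s * u))) \<partial>lborel)"
        by (subst nn_integral_cmult) auto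
      also have "\<dots> = (\<integral>\<^sup>+u. F (s * u, s * (1 - u)) * ennreal (beta_density a b u) * ennreal (gamma_density (a + b) s) \<partial>lborel)"
      proof (rule nn_integral_cong)
        fix u
        have "ennreal s * (ennreal (gamma_density a (s * u)) * ennreal (gamma_density b (s - s * u))) =
           ennreal (beta_density a b u) * ennreal (gamma_density (a + b) s)"
          using gamma_density_prod[of a b s u] True
          by (simp add: ennreal_mult[symmetric] gamma_density_nonneg beta_density_nonneg add_pos_pos)
        then have "F (s * u, s * (1 - u)) * (ennreal s * (ennreal (gamma_density a (s * u)) * ennreal (gamma_density b (s - s * u)))) =
           F (s * u, s * (1 - u)) * (ennreal (beta_density a b u) * ennreal (gamma_density (a + b) s))"
          by (rule arg_cong)
        then show "ennreal s * (F (s * u, s - s * u) * ennreal (gamma_density a (s * u)) * ennreal (gamma_density b (s - s * u))) =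
            F (s * u, s * (1 - u)) * ennreal (beta_density a b u) * ennreal (gamma_density (a + b) s)"
          by (simp add: right_diff_distrib mult_ac)
      qed
      finally show ?thesis .
    qed
  qed
  finally show ?thesis .
qed

lemma (in prob_space) nn_integral_indep_gamma:
  fixes F :: "real \<times> real \<Rightarrow> ennreal"
  assumes X: "distributed M lborel X (gamma_density a)" and Y: "distributed M lborel Y (gamma_density b)"
    and ind: "indep_var borel X borel Y" and ab: "0 < a" "0 < b" and F: "F \<in> borel_measurable borel"
  shows "(\<integral>\<^sup>+\<omega>. F (X \<omega>, Y \<omega>) \<partial>M) =
    (\<integral>\<^sup>+s. \<integral>\<^sup>+u. F (s * u, s * (1 - u)) * ennreal (beta_density a b u) * ennreal (gamma_density (a + b) s) \<partial>lborel \<partial>lborel)"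
proof -
  have ind': "indep_var lborel X lborel Y"
    using ind unfolding indep_var_eq by simp
  have "distributed M (lborel \<Otimes>\<^sub>M lborel) (\<lambda>x. (X x, Y x)) (\<lambda>(x, y). ennreal (gamma_density a x) * ennreal (gamma_density b y))"
    by (intro distributed_joint_indep sigma_finite_lborel X Y ind')
  from distributed_nn_integral[OF this, of F]
  have "(\<integral>\<^sup>+\<omega>. F (X \<omega>, Y \<omega>) \<partial>M) =
     (\<integral>\<^sup>+z. (case z of (x, y) \<Rightarrow> ennreal (gamma_density a x) * ennreal (gamma_density b y)) * F z \<partial>(lborel \<Otimes>\<^sub>M lborel))"
    using F by (simp add: lborel_prod)
  also have "\<dots> = (\<integral>\<^sup>+x. \<integral>\<^sup>+y. F (x, y) * ennreal (gamma_density a x) * ennreal (gamma_density b y) \<partial>lborel \<partial>lborel)"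
  proof -
    have [measurable]: "F \<in> borel_measurable (lborel \<Otimes>\<^sub>M lborel)" using F by (simp add: lborel_prod)
    show ?thesis by (subst lborel.nn_integral_fst[symmetric]) (auto simp: algebra_simps)
  qed
  finally show ?thesis using nn_integral_gamma_density_pair[OF ab F] by simp
qed

text \<open>For a function of the total alone the proportion \<open>u\<close> integrates to 1, which
  leaves the Gamma density of the added shapes.\<close>

lemma (in prob_space) sum_indep_gamma:
  assumes X: "distributed M lborel X (gamma_density a)" and Y: "distributed M lborel Y (gamma_density b)"
    and ind: "indep_var borel X borel Y" and ab: "0 < a" "0 < b"
  shows "distributed M lborel (\<lambda>\<omega>. X \<omega> + Y \<omega>) (gamma_density (a + b))"
  unfolding distributed_def
proof (intro conjI)
  have [measurable]: "X \<in> borel_measurable M" "Y \<in> borel_measurable M"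
    using distributed_measurable[OF X] distributed_measurable[OF Y] by simp_all
  show "(\<lambda>\<omega>. X \<omega> + Y \<omega>) \<in> M \<rightarrow>\<^sub>M lborel" by simp
  show "(\<lambda>x. ennreal (gamma_density (a + b) x)) \<in> borel_measurable lborel" by simp
  show "distr M lborel (\<lambda>\<omega>. X \<omega> + Y \<omega>) = density lborel (\<lambda>x. ennreal (gamma_density (a + b) x))"
  proof (rule measure_eqI)
    fix A assume "A \<in> sets (distr M lborel (\<lambda>\<omega>. X \<omega> + Y \<omega>))"
    then have [measurable]: "A \<in> sets borel" by simp
    have "emeasure (distr M lborel (\<lambda>\<omega>. X \<omega> + Y \<omega>)) A = (\<integral>\<^sup>+\<omega>. indicator A (X \<omega> + Y \<omega>) \<partial>M)"
      by (subst nn_integral_indicator[symmetric]) (auto simp: nn_integral_distr simp del: nn_integral_indicator)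
    also have "\<dots> = (\<integral>\<^sup>+s. \<integral>\<^sup>+u. indicator A s * ennreal (beta_density a b u) * ennreal (gamma_density (a + b) s) \<partial>lborel \<partial>lborel)"
    proof -
      have m: "(\<lambda>(x, y). indicator A (x + y) :: ennreal) \<in> borel_measurable (borel :: (real \<times> real) measure)"
        unfolding borel_prod[symmetric] by measurable
      have e: "s * u + s * (1 - u) = s" for s u :: real by (simp add: algebra_simps)
      show ?thesis using nn_integral_indep_gamma[OF X Y ind ab m] by (simp add: e)
    qed
    also have "\<dots> = (\<integral>\<^sup>+s. indicator A s * ennreal (gamma_density (a + b) s) \<partial>lborel)"
      using beta_density_integral(3)[OF ab]
      by (intro nn_integral_cong) (simp add: nn_integral_cmult nn_integral_multc)
    also have "\<dots> = emeasure (density lborel (\<lambda>x. ennreal (gamma_density (a + b) x))) A"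
      by (subst emeasure_density) (auto simp: mult.commute)
    finally show "emeasure (distr M lborel (\<lambda>\<omega>. X \<omega> + Y \<omega>)) A = \<dots>" .
  qed simp
qed

section \<open>Half squares of normal variables\<close>

lemma nn_integral_std_normal_density_symmetric:
  assumes "0 \<le> r"
  shows "(\<integral>\<^sup>+x. ennreal (std_normal_density x) * indicator {-r..r} x \<partial>lborel) =
     2 * (\<integral>\<^sup>+x. ennreal (std_normal_density x) * indicator {0..r} x \<partial>lborel)"
proof -
  have AE: "AE x in lborel. x \<noteq> (0::real)" by (rule AE_lborel_singleton)
  have "(\<integral>\<^sup>+x. ennreal (std_normal_density x) * indicator {-r..r} x \<partial>lborel) =
    (\<integral>\<^sup>+x. ennreal (std_normal_density x) * indicator {-r..0} x + ennreal (std_normal_density x) * indicator {0..r} x \<partial>lborel)"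
    by (rule nn_integral_cong_AE, rule AE_mp[OF AE], rule AE_I2) (use assms in \<open>auto simp: indicator_def\<close>)
  also have "\<dots> = (\<integral>\<^sup>+x. ennreal (std_normal_density x) * indicator {-r..0} x \<partial>lborel) + (\<integral>\<^sup>+x. ennreal (std_normal_density x) * indicator {0..r} x \<partial>lborel)"
    by (rule nn_integral_add) auto
  also have "(\<integral>\<^sup>+x. ennreal (std_normal_density x) * indicator {-r..0} x \<partial>lborel) = (\<integral>\<^sup>+x. ennreal (std_normal_density x) * indicator {0..r} x \<partial>lborel)"
    by (subst nn_integral_real_affine[where c="-1" and t=0])
       (auto simp: std_normal_density_def indicator_def intro!: nn_integral_cong)
  finally show ?thesis by (simp add: mult_2)
qed

text \<open>Under the substitution \<open>x\<^sup>2 / 2\<close> the Jacobian \<open>x\<close>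
  cancels the singularity of the Gamma density at 0 and leaves twice the normal density, the factor
  2 standing for the two square roots.\<close>

lemma nn_integral_gamma_density_half:
  assumes "0 \<le> a"
  shows "(\<integral>\<^sup>+x. ennreal (gamma_density (1/2) x) * indicator {..a} x \<partial>lborel) =
     2 * (\<integral>\<^sup>+x. ennreal (std_normal_density x) * indicator {0..sqrt (2 * a)} x \<partial>lborel)"
proof -
  have AE: "AE x in lborel. x \<noteq> (0::real)" by (rule AE_lborel_singleton)
  have sq: "(sqrt (2 * a))\<^sup>2 / 2 = a" using assms by simp
  have "(\<integral>\<^sup>+x. ennreal (gamma_density (1/2) x) * indicator {..a} x \<partial>lborel) =
    (\<integral>\<^sup>+x. ennreal (gamma_density (1/2) x) * indicator {0\<^sup>2/2..(sqrt (2 * a))\<^sup>2 / 2} x \<partial>lborel)"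
    unfolding sq by (intro nn_integral_cong) (auto simp: indicator_def gamma_density_def)
  also have "\<dots> = (\<integral>\<^sup>+x. ennreal (gamma_density (1/2) x * indicator {0\<^sup>2/2..(sqrt (2 * a))\<^sup>2 / 2} x) \<partial>lborel)"
    by (intro nn_integral_cong) (auto simp: indicator_def)
  also have "\<dots> = (\<integral>\<^sup>+x. ennreal (gamma_density (1/2) (x\<^sup>2/2) * x * indicator {0..sqrt (2 * a)} x) \<partial>lborel)"
    using assms
    by (intro nn_integral_substitution[where g="\<lambda>x. x\<^sup>2/2" and g'="\<lambda>x. x"])
       (auto intro!: derivative_eq_intros continuous_intros simp: set_borel_measurable_def)
  also have "\<dots> = (\<integral>\<^sup>+x. 2 * (ennreal (std_normal_density x) * indicator {0..sqrt (2 * a)} x) \<partial>lborel)"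
  proof (rule nn_integral_cong_AE, rule AE_mp[OF AE], rule AE_I2, rule impI)
    fix x :: real assume x: "x \<noteq> 0"
    have "gamma_density (1/2) (x\<^sup>2/2) * x = 2 * std_normal_density x" if "x > 0"
    proof -
      have "(x\<^sup>2/2) powr (1/2 - 1) = 1 / sqrt (x\<^sup>2/2)"
        using that by (subst powr_half_sqrt[symmetric]) (auto simp: powr_minus_divide[symmetric])
      also have "\<dots> = sqrt 2 / x" using that by (simp add: real_sqrt_divide)
      finally have "(x\<^sup>2/2) powr (1/2 - 1) = sqrt 2 / x" .
      moreover have "sqrt 2 / sqrt pi = 2 / sqrt (2 * pi)"
        by (simp add: real_sqrt_mult field_simps)
      then have "sqrt 2 / sqrt pi * exp (- (x\<^sup>2 / 2)) = 2 / sqrt (2 * pi) * exp (- (x\<^sup>2 / 2))" by (rule arg_cong)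
      ultimately show ?thesis using that
        by (simp add: gamma_density_def std_normal_density_def Gamma_one_half_real)
    qed
    then show "ennreal (gamma_density (1/2) (x\<^sup>2/2) * x * indicator {0..sqrt (2 * a)} x) = 2 * (ennreal (std_normal_density x) * indicator {0..sqrt (2 * a)} x)"
      using x by (cases "x > 0") (simp_all add: indicator_def ennreal_mult')
  qed
  also have "\<dots> = 2 * (\<integral>\<^sup>+x. ennreal (std_normal_density x) * indicator {0..sqrt (2 * a)} x \<partial>lborel)"
    by (rule nn_integral_cmult) simp
  finally show ?thesis .
qed

lemma (in prob_space) distributed_half_square_normal:
  assumes Z: "distributed M lborel Z std_normal_density"
  shows "distributed M lborel (\<lambda>\<omega>. (Z \<omega>)\<^sup>2 / 2) (gamma_density (1/2))"
proof (rule distributedI_borel_atMost)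
  have [measurable]: "Z \<in> borel_measurable M" using distributed_measurable[OF Z] by simp
  show "(\<lambda>\<omega>. (Z \<omega>)\<^sup>2 / 2) \<in> borel_measurable M" "gamma_density (1/2) \<in> borel_measurable borel" by simp_all
  show "AE x in lborel. 0 \<le> gamma_density (1 / 2) x" by (simp add: gamma_density_nonneg)
  define g where "g a = enn2real (\<integral>\<^sup>+x. ennreal (gamma_density (1/2) x) * indicator {..a} x \<partial>lborel)" for a
  have g: "(\<integral>\<^sup>+x. ennreal (gamma_density (1/2) x) * indicator {..a} x \<partial>lborel) = ennreal (g a)" for a
  proof -
    \<comment> \<open>The moment of order 0 is the total mass and so shows finiteness. That
      \<open>0 powr 0 = 0\<close> does no harm, because the density vanishes on the nonpositive
      axis.\<close>
    have "(\<integral>\<^sup>+x. ennreal (gamma_density (1/2) x) * indicator {..a} x \<partial>lborel) \<le> (\<integral>\<^sup>+x. ennreal (gamma_density (1/2) x * x powr 0) \<partial>lborel)"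
      by (intro nn_integral_mono) (auto simp: indicator_def gamma_density_def)
    also have "\<dots> < top" by (subst nn_integral_gamma_density_powr) auto
    finally show ?thesis unfolding g_def by simp
  qed
  show "(\<integral>\<^sup>+x. ennreal (gamma_density (1/2) x * indicator {..a} x) \<partial>lborel) = ennreal (g a)" for a
    unfolding g[symmetric] by (intro nn_integral_cong) (auto simp: indicator_def)
  show "emeasure M {\<omega> \<in> space M. (Z \<omega>)\<^sup>2 / 2 \<le> a} = ennreal (g a)" for a
  proof (cases "a \<ge> 0")
    case True
    have "{\<omega> \<in> space M. (Z \<omega>)\<^sup>2 / 2 \<le> a} = Z -` {- sqrt (2 * a).. sqrt (2 * a)} \<inter> space M"
    proof -
      have "z\<^sup>2 / 2 \<le> a \<longleftrightarrow> \<bar>z\<bar> \<le> sqrt (2 * a)" for z :: real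
        using real_sqrt_le_iff[of "z\<^sup>2" "2 * a"] by (simp add: field_simps)
      then show ?thesis by (intro set_eqI) (simp only: mem_Collect_eq Int_iff vimage_eq atLeastAtMost_iff abs_le_iff, linarith)
    qed
    then have "emeasure M {\<omega> \<in> space M. (Z \<omega>)\<^sup>2 / 2 \<le> a} = (\<integral>\<^sup>+x. ennreal (std_normal_density x) * indicator {- sqrt (2 * a).. sqrt (2 * a)} x \<partial>lborel)"
      using distributed_emeasure[OF Z] by simp
    also have "\<dots> = ennreal (g a)"
      using True by (simp add: g[symmetric] nn_integral_std_normal_density_symmetric nn_integral_gamma_density_half)
    finally show ?thesis .
  next
    case False
    have "\<not> z\<^sup>2 / 2 \<le> a" for z :: real using False zero_le_power2[of z] by linarith
    moreover have "ennreal (g a) = 0"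
      unfolding g[symmetric] using False by (auto simp: nn_integral_0_iff_AE indicator_def gamma_density_def)
    ultimately show ?thesis by simp
  qed
qed

text \<open>Halving brings the chi-squared law to unit scale, where Gamma shapes add: each square
  contributes 1/2.\<close>

lemma (in prob_space) distributed_half_sum_squares_normal:
  assumes "finite I" "I \<noteq> {}" "indep_vars (\<lambda>_. borel) Z I"
    and "\<And>i. i \<in> I \<Longrightarrow> distributed M lborel (Z i) std_normal_density"
  shows "distributed M lborel (\<lambda>\<omega>. \<Sum>i\<in>I. (Z i \<omega>)\<^sup>2 / 2) (gamma_density (real (card I) / 2))"
  using assms
proof (induct I rule: finite_ne_induct)
  case (singleton i)
  then show ?case using distributed_half_square_normal[of "Z i"] by simp
next
  case (insert i I)
  have sq: "indep_vars (\<lambda>_. borel) (\<lambda>i \<omega>. (Z i \<omega>)\<^sup>2 / 2) (insert i I)"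
    using indep_vars_compose2[OF insert(5), of "\<lambda>_ x. x\<^sup>2 / 2" "\<lambda>_. borel"] by simp
  have ind: "indep_var borel (\<lambda>\<omega>. (Z i \<omega>)\<^sup>2 / 2) borel (\<lambda>\<omega>. \<Sum>i\<in>I. (Z i \<omega>)\<^sup>2 / 2)"
    by (rule indep_vars_sum) (use insert sq in auto)
  have IH: "distributed M lborel (\<lambda>\<omega>. \<Sum>i\<in>I. (Z i \<omega>)\<^sup>2 / 2) (gamma_density (real (card I) / 2))"
    using insert by (auto intro: insert(4) indep_vars_subset)
  have "distributed M lborel (\<lambda>\<omega>. (Z i \<omega>)\<^sup>2 / 2 + (\<Sum>i\<in>I. (Z i \<omega>)\<^sup>2 / 2)) (gamma_density (1/2 + real (card I) / 2))"
    using insert by (intro sum_indep_gamma IH ind distributed_half_square_normal) (auto simp: card_gt_0_iff)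
  then show ?case using insert by (simp add: add_divide_distrib)
qed

text \<open>By homogeneity the combination is the total \<open>s\<close> times a function of the
  proportion \<open>u\<close>, so its moment splits into a Gamma moment and a Beta integral. The
  condition on \<open>t\<close> is the one that the moment of the total needs.\<close>

lemma (in prob_space) nn_integral_gamma_combination_powr:
  assumes X: "distributed M lborel X (gamma_density a)" and Y: "distributed M lborel Y (gamma_density b)"
    and ind: "indep_var borel X borel Y" and ab: "0 < a" "0 < b" and pq: "0 < p" "0 < q" and t: "0 < a + b + t"
  shows "(\<integral>\<^sup>+\<omega>. ennreal ((X \<omega> / p + Y \<omega> / q) powr t) \<partial>M) =
    ennreal (Gamma (a + b + t) / Gamma (a + b)) *
    (\<integral>\<^sup>+u. ennreal (beta_density a b u * (u / p + (1 - u) / q) powr t) \<partial>lborel)"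
proof -
  let ?J = "\<integral>\<^sup>+u. ennreal (beta_density a b u * (u / p + (1 - u) / q) powr t) \<partial>lborel"
  have F: "(\<lambda>(x, y). ennreal ((x / p + y / q) powr t)) \<in> borel_measurable (borel :: (real \<times> real) measure)"
    unfolding borel_prod[symmetric] by measurable
  have "(\<integral>\<^sup>+\<omega>. ennreal ((X \<omega> / p + Y \<omega> / q) powr t) \<partial>M) =
      (\<integral>\<^sup>+s. \<integral>\<^sup>+u. ennreal ((s * u / p + s * (1 - u) / q) powr t) * ennreal (beta_density a b u) * ennreal (gamma_density (a + b) s) \<partial>lborel \<partial>lborel)"
    using nn_integral_indep_gamma[OF X Y ind ab F] by simp
  also have "\<dots> = (\<integral>\<^sup>+s. \<integral>\<^sup>+u. ennreal (gamma_density (a + b) s * s powr t) * ennreal (beta_density a b u * (u / p + (1 - u) / q) powr t) \<partial>lborel \<partial>lborel)"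
  proof (intro nn_integral_cong)
    fix s u :: real
    let ?w = "u / p + (1 - u) / q"
    \<comment> \<open>In the first two cases one of the densities is 0 on both sides, so only
      positive bases remain, where \<open>powr\<close> is multiplicative.\<close>
    consider "s \<le> 0" | "u \<notin> {0<..<1}" | "0 < s" "u \<in> {0<..<1}" by force
    then show "ennreal ((s * u / p + s * (1 - u) / q) powr t) * ennreal (beta_density a b u) * ennreal (gamma_density (a + b) s) =
        ennreal (gamma_density (a + b) s * s powr t) * ennreal (beta_density a b u * ?w powr t)"
    proof cases
      case 3
      have "s * u / p + s * (1 - u) / q = s * ?w" by (simp add: distrib_left)
      moreover have "0 < ?w" using 3 pq by (intro add_pos_pos) auto
      ultimately have "(s * u / p + s * (1 - u) / q) powr t = s powr t * ?w powr t"
        using 3 by (simp add: powr_mult)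
      then show ?thesis
        using ab by (simp add: ennreal_mult gamma_density_nonneg beta_density_nonneg add_pos_pos mult_ac)
    qed (simp_all add: gamma_density_def beta_density_def)
  qed
  also have "\<dots> = (\<integral>\<^sup>+s. ennreal (gamma_density (a + b) s * s powr t) * ?J \<partial>lborel)"
    by (intro nn_integral_cong nn_integral_cmult) measurable
  also have "\<dots> = (\<integral>\<^sup>+s. ennreal (gamma_density (a + b) s * s powr t) \<partial>lborel) * ?J"
    by (intro nn_integral_multc) measurable
  also have "(\<integral>\<^sup>+s. ennreal (gamma_density (a + b) s * s powr t) \<partial>lborel) = ennreal (Gamma (a + b + t) / Gamma (a + b))"
    using ab t by (intro nn_integral_gamma_density_powr) auto
  finally show ?thesis .
qed

section \<open>First-order expansion of the moments at exponent 0\<close>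

lemma exp_le_quadratic:
  fixes z :: real
  assumes "\<bar>z\<bar> \<le> 1"
  shows "exp z \<le> 1 + z + z\<^sup>2"
proof (cases "0 \<le> z")
  case False
  define y where "y = - z"
  have y: "0 < y" using False by (simp add: y_def)
  \<comment> \<open>The product equals \<open>1 + y ^ 3\<close>.\<close>
  have "1 \<le> (1 - y + y\<^sup>2) * (1 + y)"
    using y by (simp add: algebra_simps power2_eq_square power3_eq_cube)
  also have "\<dots> \<le> (1 - y + y\<^sup>2) * exp y"
  proof (rule mult_left_mono)
    show "1 + y \<le> exp y" by simp
    have "0 \<le> (1 - y)\<^sup>2 + y" using y by simp
    then show "0 \<le> 1 - y + y\<^sup>2" by (simp add: power2_eq_square algebra_simps)
  qed
  finally show ?thesis by (simp add: y_def exp_minus field_simps)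
qed (use assms exp_bound in auto)

text \<open>The quadratic bound for \<open>exp\<close> is applied to \<open>t * ln (w u)\<close>,
  for \<open>t\<close> of either sign. The linear term is the expectation of
  \<open>ln (w u)\<close>, and the error is of second order in \<open>t\<close>, hence invisible in
  the derivative at 0.\<close>

lemma beta_density_expectation_powr_le:
  assumes ab: "0 < a" "0 < b" and w[measurable]: "w \<in> borel_measurable borel"
    and L: "\<And>u. 0 < u \<Longrightarrow> u < 1 \<Longrightarrow> 0 < w u \<and> \<bar>ln (w u)\<bar> \<le> L" and t: "\<bar>t\<bar> * L \<le> 1"
  shows "integrable lborel (\<lambda>u. beta_density a b u * ln (w u))"
    and "(\<integral>\<^sup>+u. ennreal (beta_density a b u * w u powr t) \<partial>lborel) \<le>
      ennreal (1 + t * (\<integral>u. beta_density a b u * ln (w u) \<partial>lborel) + t\<^sup>2 * L\<^sup>2)"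
proof -
  let ?\<beta> = "beta_density a b"
  note \<beta> = beta_density_integral[OF ab]
  have nonneg: "0 \<le> ?\<beta> u" for u by (rule beta_density_nonneg[OF ab])
  have supp: "?\<beta> u = 0" if "\<not> (0 < u \<and> u < 1)" for u using that by (auto simp: beta_density_def)
  show int: "integrable lborel (\<lambda>u. ?\<beta> u * ln (w u))"
  proof (rule Bochner_Integration.integrable_bound)
    show "integrable lborel (\<lambda>u. L * ?\<beta> u)" by (intro integrable_mult_right \<beta>)
    show "AE u in lborel. norm (?\<beta> u * ln (w u)) \<le> norm (L * ?\<beta> u)"
    proof (rule AE_I2)
      fix u show "norm (?\<beta> u * ln (w u)) \<le> norm (L * ?\<beta> u)"
      proof (cases "0 < u \<and> u < 1")
        case True
        then have "\<bar>ln (w u)\<bar> \<le> \<bar>L\<bar>" using L[of u] by auto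
        then show ?thesis using mult_left_mono[of "\<bar>ln (w u)\<bar>" "\<bar>L\<bar>" "\<bar>?\<beta> u\<bar>"] by (simp add: abs_mult mult.commute)
      qed (simp add: supp)
    qed
  qed measurable
  have bound: "?\<beta> u * w u powr t \<le> ?\<beta> u + t * (?\<beta> u * ln (w u)) + t\<^sup>2 * L\<^sup>2 * ?\<beta> u" for u
  proof (cases "0 < u \<and> u < 1")
    case True
    let ?z = "t * ln (w u)"
    have w0: "0 < w u" and le: "\<bar>ln (w u)\<bar> \<le> L" using L[of u] True by auto
    have "\<bar>?z\<bar> \<le> \<bar>t\<bar> * L" using le by (simp add: abs_mult mult_left_mono)
    then have "exp ?z \<le> 1 + ?z + ?z\<^sup>2" using t by (intro exp_le_quadratic) simp
    also have "?z\<^sup>2 \<le> t\<^sup>2 * L\<^sup>2"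
      using le power_mono[of "\<bar>ln (w u)\<bar>" L 2] by (simp add: power_mult_distrib mult_left_mono)
    finally have "exp ?z \<le> 1 + ?z + t\<^sup>2 * L\<^sup>2" by simp
    then have "w u powr t \<le> 1 + ?z + t\<^sup>2 * L\<^sup>2" using w0 by (simp add: powr_def)
    from mult_left_mono[OF this nonneg[of u]] show ?thesis by (simp add: algebra_simps)
  qed (simp add: supp)
  have I: "integrable lborel (\<lambda>u. ?\<beta> u + t * (?\<beta> u * ln (w u)) + t\<^sup>2 * L\<^sup>2 * ?\<beta> u)"
    by (intro Bochner_Integration.integrable_add integrable_mult_right \<beta> int)
  have "(\<integral>\<^sup>+u. ennreal (?\<beta> u * w u powr t) \<partial>lborel) \<le> (\<integral>\<^sup>+u. ennreal (?\<beta> u + t * (?\<beta> u * ln (w u)) + t\<^sup>2 * L\<^sup>2 * ?\<beta> u) \<partial>lborel)"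
    by (intro nn_integral_mono ennreal_leI bound)
  \<comment> \<open>The majorant is nonnegative because it dominates a nonnegative function, so its
    two integrals agree.\<close>
  also have "\<dots> = ennreal (\<integral>u. ?\<beta> u + t * (?\<beta> u * ln (w u)) + t\<^sup>2 * L\<^sup>2 * ?\<beta> u \<partial>lborel)"
    by (intro nn_integral_eq_integral I AE_I2 order_trans[OF _ bound]) (simp add: nonneg)
  also have "(\<integral>u. ?\<beta> u + t * (?\<beta> u * ln (w u)) + t\<^sup>2 * L\<^sup>2 * ?\<beta> u \<partial>lborel) =
      1 + t * (\<integral>u. ?\<beta> u * ln (w u) \<partial>lborel) + t\<^sup>2 * L\<^sup>2"
    using \<beta> int by (simp add: Bochner_Integration.integral_add Bochner_Integration.integrable_add)
  finally show "(\<integral>\<^sup>+u. ennreal (?\<beta> u * w u powr t) \<partial>lborel) \<le>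
      ennreal (1 + t * (\<integral>u. ?\<beta> u * ln (w u) \<partial>lborel) + t\<^sup>2 * L\<^sup>2)" .
qed

text \<open>The function inside the logarithm is a convex combination of \<open>1 / p\<close> and
  \<open>1 / q\<close>, which gives the bound on \<open>ln\<close>. Pulling out \<open>1 / q\<close>
  produces both \<open>- ln q\<close> and the integrand
  \<open>ln (1 - (1 - q / p) * x)\<close>.\<close>

lemma beta_density_expectation_ln:
  assumes ab: "0 < a" "0 < b" and b: "0 < q" "q \<le> p"
  shows "(\<integral>u. beta_density a b u * ln (u / p + (1 - u) / q) \<partial>lborel) =
    - ln q + Gamma (a + b) / (Gamma a * Gamma b) *
      (LBINT x:{0..1}. x powr (a - 1) * (1 - x) powr (b - 1) * ln (1 - (1 - q / p) * x))"
    and "0 < u \<Longrightarrow> u < 1 \<Longrightarrow> 0 < u / p + (1 - u) / q \<and> \<bar>ln (u / p + (1 - u) / q)\<bar> \<le> \<bar>ln p\<bar> + \<bar>ln q\<bar>"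
proof -
  have p: "0 < p" using b by simp
  have w: "1 / p \<le> u / p + (1 - u) / q \<and> u / p + (1 - u) / q \<le> 1 / q" if "0 < u" "u < 1" for u
  proof -
    have pq: "1 / p \<le> 1 / q" using b p by (simp add: frac_le)
    have "u * (1 / p) \<le> u * (1 / q)" "(1 - u) * (1 / p) \<le> (1 - u) * (1 / q)"
      using pq that by (auto intro!: mult_left_mono simp del: times_divide_eq_right)
    then show ?thesis by (simp add: diff_divide_distrib)
  qed
  have B: "0 < u / p + (1 - u) / q \<and> \<bar>ln (u / p + (1 - u) / q)\<bar> \<le> \<bar>ln p\<bar> + \<bar>ln q\<bar>" if "0 < u" "u < 1" for u
  proof -
    have 1: "0 < 1 / p" using p by simp
    then have 2: "0 < u / p + (1 - u) / q" using w[OF that] by linarith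
    have "ln (1 / p) \<le> ln (u / p + (1 - u) / q)" "ln (u / p + (1 - u) / q) \<le> ln (1 / q)"
      using w[OF that] 1 2 b by (auto simp del: ln_div)
    then show ?thesis using 2 p b by (simp add: ln_div)
  qed
  then show "0 < u \<Longrightarrow> u < 1 \<Longrightarrow> 0 < u / p + (1 - u) / q \<and> \<bar>ln (u / p + (1 - u) / q)\<bar> \<le> \<bar>ln p\<bar> + \<bar>ln q\<bar>" .
  let ?f = "\<lambda>x. indicator {0..1} x *\<^sub>R (x powr (a - 1) * (1 - x) powr (b - 1) * ln (1 - (1 - q / p) * x))"
  have eq: "?f x = Beta a b * (beta_density a b x * ln (x / p + (1 - x) / q) + ln q * beta_density a b x)" for x
  proof (cases "0 < x \<and> x < 1")
    case True
    have "1 - (1 - q / p) * x = q * (x / p + (1 - x) / q)" using b p by (simp add: field_simps)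
    then have "ln (1 - (1 - q / p) * x) = ln q + ln (x / p + (1 - x) / q)"
      using B[of x] True b by (simp add: ln_mult)
    then show ?thesis using True Beta_real_pos[OF ab]
      by (simp add: beta_density_def field_simps)
  next
    \<comment> \<open>At the endpoints \<open>0 powr _ = 0\<close>, whatever the exponent, so the
      closed interval of integration agrees with the open support of the density.\<close>
    case False
    then show ?thesis by (auto simp: beta_density_def indicator_def)
  qed
  have int: "integrable lborel (\<lambda>u. beta_density a b u * ln (u / p + (1 - u) / q))"
    \<comment> \<open>With \<open>t = 0\<close> the smallness condition is void.\<close>
    by (rule beta_density_expectation_powr_le(1)[where t=0, OF ab _ B]) auto
  have "(LBINT x:{0..1}. x powr (a - 1) * (1 - x) powr (b - 1) * ln (1 - (1 - q / p) * x)) =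
     Beta a b * ((\<integral>u. beta_density a b u * ln (u / p + (1 - u) / q) \<partial>lborel) + ln q)"
    unfolding set_lebesgue_integral_def eq
    using int beta_density_integral[OF ab] by simp
  moreover have "Gamma (a + b) / (Gamma a * Gamma b) = 1 / Beta a b" by (simp add: Beta_def)
  ultimately show "(\<integral>u. beta_density a b u * ln (u / p + (1 - u) / q) \<partial>lborel) =
    - ln q + Gamma (a + b) / (Gamma a * Gamma b) *
      (LBINT x:{0..1}. x powr (a - 1) * (1 - x) powr (b - 1) * ln (1 - (1 - q / p) * x))"
    using Beta_real_pos[OF ab] by simp
qed

text \<open>The logarithmic derivative of Gamma is Digamma, and the quadratic term has slope 0. The
  argument \<open>t / 2\<close>, and with it the factor 1/2, appears because a \<open>t\<close>-th
  power of a norm is a \<open>t / 2\<close>-th power of its square.\<close>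

lemma has_real_derivative_Gamma_quotient:
  assumes "0 < (c::real)"
  shows "((\<lambda>t. Gamma (c + t / 2) / Gamma c * (1 + t / 2 * e + (t / 2)\<^sup>2 * L)) has_real_derivative (1 / 2 * (Digamma c + e))) (at 0)"
proof -
  have "c \<notin> \<int>\<^sub>\<le>\<^sub>0" using assms by (auto simp: nonpos_Ints_def)
  then show ?thesis using Gamma_real_pos[OF assms]
    by (auto intro!: derivative_eq_intros simp: field_simps)
qed

section \<open>Isotropy of Gaussian laws\<close>

lemma nn_integral_lborel_translation:
  fixes f :: "'a::euclidean_space \<Rightarrow> ennreal"
  assumes [measurable]: "f \<in> borel_measurable borel"
  shows "(\<integral>\<^sup>+x. f (t + x) \<partial>lborel) = (\<integral>\<^sup>+x. f x \<partial>lborel)"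
proof -
  have "(\<integral>\<^sup>+x. f x \<partial>lborel) = (\<integral>\<^sup>+x. f x \<partial>distr lborel borel ((+) t))"
    by (simp add: lborel_distr_plus)
  also have "\<dots> = (\<integral>\<^sup>+x. f (t + x) \<partial>lborel)"
    by (subst nn_integral_distr) auto
  finally show ?thesis ..
qed

text \<open>Haar uniqueness in miniature: the isometry fixes the indicator of the unit ball, so integrating
  the image of \<open>A\<close> against that indicator in both orders shows that no volume factor can appear.\<close>

lemma lborel_distr_linear_isometry:
  fixes T :: "'a::euclidean_space \<Rightarrow> 'a"
  assumes T: "linear T" and norm_T: "\<And>x. norm (T x) = norm x"
  shows "distr lborel borel T = lborel"
proof (rule measure_eqI)
  show "sets (distr lborel borel T) = sets lborel" by simp
  have [measurable]: "T \<in> borel_measurable borel"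
    by (intro borel_measurable_continuous_onI linear_continuous_on linear_conv_bounded_linear[THEN iffD1] T)
  have "inj T"
    using T norm_T by (metis linear_injective_0 norm_eq_zero)
  then have surj: "surj T" using T linear_injective_imp_surjective by blast
  \<comment> \<open>The unit ball is invariant under \<open>T\<close> and under negation, and its
    volume is neither 0 nor infinite, so the factor \<open>c\<close> can be cancelled at the
    end.\<close>
  define e :: "'a \<Rightarrow> ennreal" where "e = indicator (ball 0 1)"
  have [measurable]: "e \<in> borel_measurable borel"
    unfolding e_def by (intro borel_measurable_indicator borel_open open_ball)
  have eT: "e (- T x) = e x" for x by (simp add: e_def indicator_def norm_T)
  define c where "c = (\<integral>\<^sup>+x. e x \<partial>lborel)"
  have c: "c = emeasure lborel (ball (0::'a) 1)" by (simp add: c_def e_def)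
  have "c \<noteq> \<infinity>" using emeasure_lborel_ball_finite[of "0::'a" 1] by (simp add: c)
  moreover have "c \<noteq> 0"
  proof
    assume "c = 0"
    then have "AE x in lborel. x \<notin> ball (0::'a) 1"
      unfolding c by (intro AE_not_in) (auto simp: null_sets_def)
    then have "negligible (ball (0::'a) 1)"
      by (metis Collect_mem_eq c \<open>c = 0\<close> emeasure_eq_0_AE negligible_iff_null_sets null_setsI null_sets_completionI borel_open open_ball sets_lborel)
    then show False using open_not_negligible[of "ball (0::'a) 1"] by simp
  qed
  ultimately have c0: "c * x = c * y \<longleftrightarrow> x = y" for x y
    by (simp add: ennreal_mult_cancel_left)
  fix A :: "'a set" assume "A \<in> sets (distr lborel borel T)"
  then have [measurable]: "A \<in> sets borel" by simp
  have "c * emeasure (distr lborel borel T) A = c * (\<integral>\<^sup>+x. indicator A (T x) \<partial>lborel)"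
    by (subst nn_integral_indicator[symmetric]) (auto simp: nn_integral_distr simp del: nn_integral_indicator)
  also have "\<dots> = (\<integral>\<^sup>+x. c * indicator A (T x) \<partial>lborel)"
    by (rule nn_integral_cmult[symmetric]) measurable
  also have "\<dots> = (\<integral>\<^sup>+x. \<integral>\<^sup>+y. e (- T x + y) * indicator A (T x) \<partial>lborel \<partial>lborel)"
  proof (rule nn_integral_cong)
    fix x
    have "c = (\<integral>\<^sup>+y. e (- T x + y) \<partial>lborel)"
      unfolding c_def by (rule nn_integral_lborel_translation[symmetric]) measurable
    then show "c * indicator A (T x) = (\<integral>\<^sup>+y. e (- T x + y) * indicator A (T x) \<partial>lborel)"
      by (simp add: nn_integral_multc)
  qed
  also have "\<dots> = (\<integral>\<^sup>+y. \<integral>\<^sup>+x. e (- T x + y) * indicator A (T x) \<partial>lborel \<partial>lborel)"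
    by (rule lborel_pair.Fubini') measurable
  also have "\<dots> = (\<integral>\<^sup>+y. \<integral>\<^sup>+x. e x * indicator A (T x + y) \<partial>lborel \<partial>lborel)"
  proof (rule nn_integral_cong)
    fix y
    \<comment> \<open>Writing the shift as \<open>T z\<close> turns a translation of the inner
      variable by \<open>z\<close> into a translation of its image by \<open>y\<close>; this moves
      \<open>y\<close> from \<open>e\<close> into the indicator of \<open>A\<close>.\<close>
    obtain z where z: "y = T z" using surj by (metis surjE)
    have "(\<integral>\<^sup>+x. e (- T x + y) * indicator A (T x) \<partial>lborel) = (\<integral>\<^sup>+x. e (- T (z + x) + y) * indicator A (T (z + x)) \<partial>lborel)"
      by (rule nn_integral_lborel_translation[symmetric]) measurable
    also have "\<dots> = (\<integral>\<^sup>+x. e x * indicator A (T x + y) \<partial>lborel)"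
      using eT by (simp add: z linear_add[OF T] add.commute)
    finally show "(\<integral>\<^sup>+x. e (- T x + y) * indicator A (T x) \<partial>lborel) = \<dots>" .
  qed
  also have "\<dots> = (\<integral>\<^sup>+x. \<integral>\<^sup>+y. e x * indicator A (T x + y) \<partial>lborel \<partial>lborel)"
    by (rule lborel_pair.Fubini') measurable
  also have "\<dots> = (\<integral>\<^sup>+x. e x * emeasure lborel A \<partial>lborel)"
  proof (rule nn_integral_cong)
    fix x
    have "(\<integral>\<^sup>+y. indicator A (T x + y) \<partial>lborel) = emeasure lborel A"
      using nn_integral_lborel_translation[of "indicator A" "T x"] by simp
    then show "(\<integral>\<^sup>+y. e x * indicator A (T x + y) \<partial>lborel) = e x * emeasure lborel A"
      by (simp add: nn_integral_cmult)
  qed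
  also have "\<dots> = c * emeasure lborel A"
    by (simp add: nn_integral_multc c_def)
  finally show "emeasure (distr lborel borel T) A = emeasure lborel A" using c0 by simp
qed

section \<open>The standard Gaussian law on a Euclidean space\<close>

abbreviation std_normal :: "real measure" where
  "std_normal \<equiv> density lborel std_normal_density"

text \<open>Independent coordinates are the form in which a matrix entry delivers its law;
  invariance is read off from the density in \<open>std_gaussian_eq_density\<close>.\<close>

definition std_gaussian :: "'a::euclidean_space measure" where
  "std_gaussian = distr (\<Pi>\<^sub>M b\<in>Basis. std_normal) borel (\<lambda>f. \<Sum>b\<in>Basis. f b *\<^sub>R b)"

lemma prob_space_std_normal: "prob_space std_normal"
  by (rule prob_space_normal_density) simp

text \<open>Boxes determine a finite product measure, and on a box the integral splits into one
  factor per coordinate.\<close>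

lemma PiM_density_lborel:
  fixes n :: "real \<Rightarrow> ennreal"
  assumes I: "finite I" and [measurable]: "n \<in> borel_measurable borel" and P: "prob_space (density lborel n)"
  shows "density (\<Pi>\<^sub>M i\<in>I. lborel) (\<lambda>\<omega>. \<Prod>i\<in>I. n (\<omega> i)) = (\<Pi>\<^sub>M i\<in>I. density lborel n)"
proof -
  interpret product_prob_space "\<lambda>_. density lborel n" I
    by (intro product_prob_spaceI P)
  interpret L: product_sigma_finite "\<lambda>_. lborel :: real measure" by standard
  show ?thesis
  proof (rule PiM_eqI[OF I])
    show "sets (density (\<Pi>\<^sub>M i\<in>I. lborel) (\<lambda>\<omega>. \<Prod>i\<in>I. n (\<omega> i))) = sets (\<Pi>\<^sub>M i\<in>I. density lborel n)"
      by (simp, intro sets_PiM_cong) auto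
    fix A assume A: "\<And>i. i \<in> I \<Longrightarrow> A i \<in> sets (density lborel n)"
    then have A': "\<And>i. i \<in> I \<Longrightarrow> A i \<in> sets borel" by simp
    have S: "Pi\<^sub>E I A \<in> sets (\<Pi>\<^sub>M i\<in>I. lborel)" using I A' by (intro sets_PiM_I_finite) auto
    have "emeasure (density (\<Pi>\<^sub>M i\<in>I. lborel) (\<lambda>\<omega>. \<Prod>i\<in>I. n (\<omega> i))) (Pi\<^sub>E I A) =
        (\<integral>\<^sup>+\<omega>. (\<Prod>i\<in>I. n (\<omega> i)) * indicator (Pi\<^sub>E I A) \<omega> \<partial>(\<Pi>\<^sub>M i\<in>I. lborel))"
      using S by (subst emeasure_density) auto
    also have "\<dots> = (\<integral>\<^sup>+\<omega>. (\<Prod>i\<in>I. n (\<omega> i) * indicator (A i) (\<omega> i)) \<partial>(\<Pi>\<^sub>M i\<in>I. lborel))"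
    proof (rule nn_integral_cong)
      fix \<omega> :: "_ \<Rightarrow> real" assume "\<omega> \<in> space (\<Pi>\<^sub>M i\<in>I. lborel)"
      then have "\<omega> \<in> Pi\<^sub>E I A \<longleftrightarrow> (\<forall>i\<in>I. \<omega> i \<in> A i)"
        by (auto simp: space_PiM PiE_iff)
      then have "indicator (Pi\<^sub>E I A) \<omega> = (\<Prod>i\<in>I. indicator (A i) (\<omega> i) :: ennreal)"
        using I by (auto simp: indicator_def)
      then show "(\<Prod>i\<in>I. n (\<omega> i)) * indicator (Pi\<^sub>E I A) \<omega> = (\<Prod>i\<in>I. n (\<omega> i) * indicator (A i) (\<omega> i))"
        by (simp add: prod.distrib)
    qed
    also have "\<dots> = (\<Prod>i\<in>I. \<integral>\<^sup>+x. n x * indicator (A i) x \<partial>lborel)"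
      using A' by (intro L.product_nn_integral_prod I) auto
    also have "\<dots> = (\<Prod>i\<in>I. emeasure (density lborel n) (A i))"
      using A' by (intro prod.cong refl) (simp add: emeasure_density)
    finally show "emeasure (density (\<Pi>\<^sub>M i\<in>I. lborel) (\<lambda>\<omega>. \<Prod>i\<in>I. n (\<omega> i))) (Pi\<^sub>E I A) = \<dots>" .
  qed
qed

text \<open>The exponents of the coordinate densities add up to the squared norm, so the joint
  density sees \<open>x\<close> only through \<open>norm x\<close>.\<close>

lemma std_gaussian_eq_density:
  "(std_gaussian :: 'a::euclidean_space measure) =
     density lborel (\<lambda>x. ennreal ((1 / sqrt (2 * pi)) ^ DIM('a) * exp (- (norm x)\<^sup>2 / 2)))"
proof -
  let ?n = "\<lambda>x. ennreal (std_normal_density x)"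
  let ?S = "\<lambda>f. \<Sum>b\<in>Basis. f b *\<^sub>R (b::'a)"
  have d: "(\<Prod>b\<in>Basis. ?n (x \<bullet> b)) = ennreal ((1 / sqrt (2 * pi)) ^ DIM('a) * exp (- (norm x)\<^sup>2 / 2))" for x :: 'a
  proof -
    have "(\<Prod>b\<in>Basis. ?n (x \<bullet> b)) = ennreal (\<Prod>b\<in>Basis. std_normal_density (x \<bullet> b))"
      by (rule prod_ennreal) simp
    also have "(\<Prod>b\<in>Basis. std_normal_density (x \<bullet> b)) = (1 / sqrt (2 * pi)) ^ DIM('a) * exp (\<Sum>b\<in>Basis. - (x \<bullet> b)\<^sup>2 / 2)"
      unfolding std_normal_density_def prod.distrib by (simp add: exp_sum)
    also have "(\<Sum>b\<in>Basis. - (x \<bullet> b)\<^sup>2 / 2) = - (norm x)\<^sup>2 / 2"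
    proof -
      have "(norm x)\<^sup>2 = (\<Sum>b\<in>Basis. (x \<bullet> b)\<^sup>2)"
        unfolding power2_norm_eq_inner by (subst euclidean_inner) (simp add: power2_eq_square)
      then show ?thesis by (simp add: sum_negf flip: sum_divide_distrib)
    qed
    finally show ?thesis .
  qed
  \<comment> \<open>\<open>lborel\<close> is itself the image of a product of Lebesgue measures
    under \<open>?S\<close>, so the density can be pulled back to coordinates.\<close>
  have "density lborel (\<lambda>x::'a. \<Prod>b\<in>Basis. ?n (x \<bullet> b)) = density (distr (\<Pi>\<^sub>M b\<in>Basis. lborel) borel ?S) (\<lambda>x. \<Prod>b\<in>Basis. ?n (x \<bullet> b))"
    by (simp add: lborel_eq[symmetric])
  also have "\<dots> = distr (density (\<Pi>\<^sub>M b\<in>Basis. lborel) (\<lambda>f. \<Prod>b\<in>Basis. ?n (?S f \<bullet> b))) borel ?S"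
    by (rule density_distr) measurable
  also have "(\<lambda>f. \<Prod>b\<in>Basis. ?n (?S f \<bullet> b)) = (\<lambda>f. \<Prod>b\<in>Basis. ?n (f b))"
    by simp
  also have "density (\<Pi>\<^sub>M b\<in>Basis. lborel) (\<lambda>f. \<Prod>b\<in>Basis. ?n (f (b::'a))) = (\<Pi>\<^sub>M b\<in>Basis. std_normal)"
    by (rule PiM_density_lborel) (auto intro: prob_space_std_normal)
  finally show ?thesis unfolding std_gaussian_def d ..
qed

lemma sets_std_gaussian [simp, measurable_cong]: "sets std_gaussian = sets borel"
  by (simp add: std_gaussian_def)

lemma distr_std_gaussian_linear_isometry:
  fixes T :: "'a::euclidean_space \<Rightarrow> 'a"
  assumes T: "linear T" and norm_T: "\<And>x. norm (T x) = norm x"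
  shows "distr std_gaussian borel T = std_gaussian"
proof -
  have [measurable]: "T \<in> borel_measurable borel"
    by (intro borel_measurable_continuous_onI linear_continuous_on linear_conv_bounded_linear[THEN iffD1] T)
  let ?f = "\<lambda>x::'a. ennreal ((1 / sqrt (2 * pi)) ^ DIM('a) * exp (- (norm x)\<^sup>2 / 2))"
  have "distr std_gaussian borel T = distr (density lborel (\<lambda>x. ?f (T x))) borel T"
    by (simp add: std_gaussian_eq_density norm_T)
  also have "\<dots> = density (distr lborel borel T) ?f"
    by (rule density_distr[symmetric]) measurable
  finally show ?thesis
    by (simp add: lborel_distr_linear_isometry[OF T norm_T] std_gaussian_eq_density)
qed

text \<open>Multiplicativity of the norm makes right multiplication by the unit scalar
  \<open>v /\<^sub>R norm v\<close> a linear isometry. The side matters over the quaternions: in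
  \<open>A *v v\<close> the entries of the vector stand on the right.\<close>

lemma distr_std_gaussian_mult_right:
  fixes v :: "'a::{real_normed_div_algebra,euclidean_space}"
  shows "distr std_gaussian borel (\<lambda>x. x * v) = distr std_gaussian borel (\<lambda>x. norm v *\<^sub>R x)"
proof (cases "v = 0")
  case False
  define u where "u = v /\<^sub>R norm v"
  have v: "v = norm v *\<^sub>R u" using False by (simp add: u_def)
  have u: "norm u = 1" using False by (simp add: u_def)
  have i: "distr std_gaussian borel (\<lambda>x. x * u) = std_gaussian"
    by (rule distr_std_gaussian_linear_isometry)
      (auto intro!: linearI simp: distrib_right norm_mult u)
  have [measurable]: "(\<lambda>x. x * u) \<in> borel_measurable borel"
    by (intro borel_measurable_continuous_onI continuous_intros)
  have "distr std_gaussian borel (\<lambda>x. norm v *\<^sub>R x) = distr (distr std_gaussian borel (\<lambda>x. x * u)) borel (\<lambda>x. norm v *\<^sub>R x)"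
    unfolding i ..
  also have "\<dots> = distr std_gaussian borel (\<lambda>x. norm v *\<^sub>R (x * u))"
    by (subst distr_distr) (auto simp: o_def)
  also have "(\<lambda>x. norm v *\<^sub>R (x * u)) = (\<lambda>x. x * v)"
    by (subst (2) v) simp
  finally show ?thesis ..
qed simp

section \<open>Exponential growth of random products\<close>

lemma borel_measurable_matrix_mult [measurable]:
  fixes A B :: "'w \<Rightarrow> 'a::{real_normed_algebra_1,euclidean_space} ^ 'n ^ 'n"
  assumes "A \<in> borel_measurable M" "B \<in> borel_measurable M"
  shows "(\<lambda>\<omega>. A \<omega> ** B \<omega>) \<in> borel_measurable M"
  using assms by (rule borel_measurable_continuous_Pair)
    (auto simp: matrix_matrix_mult_def intro!: continuous_intros)

lemma borel_measurable_matrix_vector_mult [measurable]: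
  fixes A :: "'w \<Rightarrow> 'a::{real_normed_algebra_1,euclidean_space} ^ 'n ^ 'n"
  assumes "A \<in> borel_measurable M" "v \<in> borel_measurable M"
  shows "(\<lambda>\<omega>. A \<omega> *v v \<omega>) \<in> borel_measurable M"
  using assms by (rule borel_measurable_continuous_Pair)
    (auto simp: matrix_vector_mult_def intro!: continuous_intros)

lemma mat_prod_cong:
  "(\<And>k. k \<in> {1..m} \<Longrightarrow> A k = B k) \<Longrightarrow> mat_prod A m = mat_prod B m"
  by (induction m) auto

lemma borel_measurable_mat_prod:
  fixes X :: "nat \<Rightarrow> 'w \<Rightarrow> 'a::{real_normed_algebra_1,euclidean_space} ^ 'n ^ 'n"
  assumes "\<And>k. k \<in> {1..m} \<Longrightarrow> X k \<in> borel_measurable M"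
  shows "(\<lambda>\<omega>. mat_prod (\<lambda>k. X k \<omega>) m) \<in> borel_measurable M"
  using assms by (induction m) auto

text \<open>Fubini on the joint law. The inner integral is taken over a second sample with
  \<open>Y\<close> frozen, which is where a statement about fixed vectors can be applied.\<close>

lemma (in prob_space) nn_integral_indep_var:
  assumes ind: "indep_var S X T Y" and [measurable]: "(\<lambda>(x, y). h x y) \<in> borel_measurable (S \<Otimes>\<^sub>M T)"
  shows "(\<integral>\<^sup>+\<omega>. h (X \<omega>) (Y \<omega>) \<partial>M) = (\<integral>\<^sup>+\<omega>. \<integral>\<^sup>+\<omega>'. h (X \<omega>') (Y \<omega>) \<partial>M \<partial>M)"
proof -
  have [measurable]: "X \<in> measurable M S" "Y \<in> measurable M T"
    using ind by (auto dest: indep_var_rv1 indep_var_rv2)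
  interpret X: prob_space "distr M S X" by (rule prob_space_distr) measurable
  interpret Y: prob_space "distr M T Y" by (rule prob_space_distr) measurable
  interpret XY: pair_sigma_finite "distr M S X" "distr M T Y" ..
  have "(\<integral>\<^sup>+\<omega>. h (X \<omega>) (Y \<omega>) \<partial>M) = (\<integral>\<^sup>+z. (\<lambda>(x, y). h x y) z \<partial>distr M (S \<Otimes>\<^sub>M T) (\<lambda>\<omega>. (X \<omega>, Y \<omega>)))"
    by (subst nn_integral_distr) auto
  also have "\<dots> = (\<integral>\<^sup>+z. (\<lambda>(x, y). h x y) z \<partial>(distr M S X \<Otimes>\<^sub>M distr M T Y))"
    using ind by (simp add: indep_var_distribution_eq)
  also have "\<dots> = (\<integral>\<^sup>+y. \<integral>\<^sup>+x. h x y \<partial>distr M S X \<partial>distr M T Y)"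
    by (subst XY.nn_integral_snd[symmetric]) auto
  also have "\<dots> = (\<integral>\<^sup>+\<omega>. \<integral>\<^sup>+x. h x (Y \<omega>) \<partial>distr M S X \<partial>M)"
    by (subst nn_integral_distr) (auto intro: measurable_compose)
  also have "\<dots> = (\<integral>\<^sup>+\<omega>. \<integral>\<^sup>+\<omega>'. h (X \<omega>') (Y \<omega>) \<partial>M \<partial>M)"
    by (intro nn_integral_cong, subst nn_integral_distr) (auto dest: measurable_space)
  finally show ?thesis .
qed

text \<open>Because \<kappa> does not depend on the direction of \<open>v\<close>, the newest factor
  contributes exactly \<kappa> whatever the earlier product did, and no stationary law of directions
  has to be found.\<close>

lemma (in prob_space) nn_integral_norm_mat_prod_powr:
  fixes X :: "nat \<Rightarrow> 'a \<Rightarrow> 'k::{real_normed_algebra_1,euclidean_space} ^ 'n ^ 'n"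
  assumes ind: "indep_vars (\<lambda>_. borel) X {1..}"
    and step: "\<And>m v. 1 \<le> m \<Longrightarrow> (\<integral>\<^sup>+\<omega>. ennreal (norm (X m \<omega> *v v) powr t) \<partial>M) = \<kappa> * ennreal (norm v powr t)"
  shows "(\<integral>\<^sup>+\<omega>. ennreal (norm (mat_prod (\<lambda>k. X k \<omega>) m *v y) powr t) \<partial>M) = \<kappa> ^ m * ennreal (norm y powr t)"
proof (induction m)
  case 0
  then show ?case by (simp add: emeasure_space_1)
next
  case (Suc m)
  let ?P = "\<lambda>\<omega>. mat_prod (\<lambda>k. X k \<omega>) m"
  \<comment> \<open>\<open>mat_prod\<close> up to \<open>m\<close> reads only the indices 1 to
    \<open>m\<close>, a block disjoint from the index of the new factor.\<close>
  have "indep_var (PiM {Suc m} (\<lambda>_. borel)) (\<lambda>\<omega>. restrict (\<lambda>i. X i \<omega>) {Suc m})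
      (PiM {1..m} (\<lambda>_. borel)) (\<lambda>\<omega>. restrict (\<lambda>i. X i \<omega>) {1..m})"
    by (rule indep_var_restrict[OF ind]) auto
  then have "indep_var borel ((\<lambda>f. f (Suc m)) \<circ> (\<lambda>\<omega>. restrict (\<lambda>i. X i \<omega>) {Suc m}))
      borel ((\<lambda>f. mat_prod (\<lambda>k. f k) m) \<circ> (\<lambda>\<omega>. restrict (\<lambda>i. X i \<omega>) {1..m}))"
  proof (rule indep_var_compose)
    show "(\<lambda>f. f (Suc m)) \<in> borel_measurable (PiM {Suc m} (\<lambda>_. borel))" by measurable
    show "(\<lambda>f. mat_prod (\<lambda>k. f k) m :: 'k ^ 'n ^ 'n) \<in> borel_measurable (PiM {1..m} (\<lambda>_. borel))"
      by (rule borel_measurable_mat_prod) measurable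
  qed
  also have "(\<lambda>f. f (Suc m)) \<circ> (\<lambda>\<omega>. restrict (\<lambda>i. X i \<omega>) {Suc m}) = X (Suc m)"
    by auto
  also have "(\<lambda>f. mat_prod (\<lambda>k. f k) m) \<circ> (\<lambda>\<omega>. restrict (\<lambda>i. X i \<omega>) {1..m}) = ?P"
    by (rule ext, unfold comp_def, rule mat_prod_cong) simp
  finally have iv: "indep_var borel (X (Suc m)) borel ?P" .
  have [measurable]: "?P \<in> borel_measurable M" using iv by (rule indep_var_rv2)
  have "(\<integral>\<^sup>+\<omega>. ennreal (norm (mat_prod (\<lambda>k. X k \<omega>) (Suc m) *v y) powr t) \<partial>M) =
      (\<integral>\<^sup>+\<omega>. ennreal (norm (X (Suc m) \<omega> *v (?P \<omega> *v y)) powr t) \<partial>M)"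
    by (simp add: matrix_vector_mul_assoc)
  also have "\<dots> = (\<integral>\<^sup>+\<omega>. \<integral>\<^sup>+\<omega>'. ennreal (norm (X (Suc m) \<omega>' *v (?P \<omega> *v y)) powr t) \<partial>M \<partial>M)"
    by (rule nn_integral_indep_var[OF iv]) measurable
  also have "\<dots> = (\<integral>\<^sup>+\<omega>. \<kappa> * ennreal (norm (?P \<omega> *v y) powr t) \<partial>M)"
    by (simp add: step)
  also have "\<dots> = \<kappa> * (\<integral>\<^sup>+\<omega>. ennreal (norm (?P \<omega> *v y) powr t) \<partial>M)"
    by (intro nn_integral_cmult) measurable
  finally show ?case by (simp add: Suc.IH mult.assoc)
qed

text \<open>The function \<open>U t * exp (- t * c)\<close> has value 1 and slope
  \<open>l - c\<close> at 0, so it drops below 1 on the side where \<open>t\<close> has the sign of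
  \<open>c - l\<close>.\<close>

lemma exists_powr_lt_exp:
  fixes U :: "real \<Rightarrow> real"
  assumes U: "U 0 = 1" "(U has_real_derivative l) (at 0)" and "0 < \<delta>" and "c \<noteq> l"
  obtains t where "\<bar>t\<bar> < \<delta>" "U t < exp (t * c)" "0 < t * (c - l)"
proof -
  define f where "f t = U t * exp (- t * c)" for t
  have f0: "f 0 = 1" by (simp add: f_def U)
  have D: "(f has_real_derivative (l - c)) (at 0)"
    unfolding f_def[abs_def] by (rule derivative_eq_intros U refl | simp add: U)+
  have less: "U t < exp (t * c)" if "f t < f 0" for t
    using that unfolding f0 by (simp add: f_def exp_minus field_simps)
  show ?thesis
  proof (cases "l < c")
    case True
    obtain d where d: "0 < d" "\<And>h. 0 < h \<Longrightarrow> h < d \<Longrightarrow> f (0 + h) < f 0"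
      using DERIV_neg_dec_right[OF D] True by auto
    have m: "0 < min d \<delta> / 2" "min d \<delta> / 2 < d" "min d \<delta> / 2 < \<delta>" using d(1) \<open>0 < \<delta>\<close> by auto
    show ?thesis using less[of "min d \<delta> / 2"] d(2)[OF m(1,2)] m True
      by (intro that[of "min d \<delta> / 2"]) (auto intro!: mult_pos_pos)
  next
    case False
    then have c: "c < l" using \<open>c \<noteq> l\<close> by simp
    obtain d where d: "0 < d" "\<And>h. 0 < h \<Longrightarrow> h < d \<Longrightarrow> f (0 - h) < f 0"
      using DERIV_pos_inc_left[OF D] c by auto
    have m: "0 < min d \<delta> / 2" "min d \<delta> / 2 < d" "min d \<delta> / 2 < \<delta>" using d(1) \<open>0 < \<delta>\<close> by auto
    have "0 < (- (min d \<delta> / 2)) * (c - l)" using m(1) c by (intro mult_neg_neg) auto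
    then show ?thesis using less[of "- (min d \<delta> / 2)"] d(2)[OF m(1,2)] m
      by (intro that[of "- (min d \<delta> / 2)"]) auto
  qed
qed

section \<open>Deterministic control by the basis vectors\<close>

lemma matrix_vector_mult_axis:
  fixes P :: "'a::semiring_1 ^ 'n ^ 'm"
  shows "(P *v axis j 1) $ i = P $ i $ j"
  by (simp add: matrix_vector_mult_def axis_def if_distrib cong: if_cong)

text \<open>The constant may be crude, since its logarithm disappears after division by
  \<open>m\<close>; what counts is that it does not depend on \<open>P\<close>.\<close>

lemma norm_matrix_vector_mult_le:
  fixes P :: "'a::real_normed_algebra_1 ^ 'n ^ 'm"
  assumes "\<And>j. norm (P *v axis j 1) \<le> c"
  shows "norm (P *v y) \<le> (real CARD('m) * (\<Sum>j\<in>UNIV. norm (y $ j))) * c"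
proof -
  have "norm (P *v y) \<le> (\<Sum>i\<in>UNIV. norm ((P *v y) $ i))"
    unfolding norm_vec_def by (rule L2_set_le_sum) simp
  also have "\<dots> \<le> (\<Sum>i\<in>(UNIV::'m set). \<Sum>j\<in>UNIV. norm (y $ j) * c)"
  proof (rule sum_mono)
    fix i
    have "norm ((P *v y) $ i) \<le> (\<Sum>j\<in>UNIV. norm (P $ i $ j * y $ j))"
      unfolding matrix_vector_mult_def by (simp add: norm_sum)
    also have "\<dots> \<le> (\<Sum>j\<in>UNIV. norm (y $ j) * c)"
    proof (rule sum_mono)
      fix j
      have "norm (P $ i $ j) \<le> c"
        using assms[of j] Finite_Cartesian_Product.norm_nth_le[of "P *v axis j 1" i] by (simp add: matrix_vector_mult_axis)
      then have "norm (P $ i $ j) * norm (y $ j) \<le> c * norm (y $ j)"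
        by (rule mult_right_mono) simp
      then show "norm (P $ i $ j * y $ j) \<le> norm (y $ j) * c"
        using norm_mult_ineq[of "P $ i $ j" "y $ j"] by (simp add: mult.commute)
    qed
    finally show "norm ((P *v y) $ i) \<le> (\<Sum>j\<in>UNIV. norm (y $ j) * c)" .
  qed
  also have "\<dots> = (real CARD('m) * (\<Sum>j\<in>UNIV. norm (y $ j))) * c"
    by (simp add: sum_distrib_right)
  finally show ?thesis .
qed

lemma growth_rate_lim_le:
  fixes A :: "nat \<Rightarrow> 'a::real_normed_algebra_1 ^ 'n ^ 'n"
  assumes e: "\<And>j. growth_rate A (axis j 1) \<longlonglongrightarrow> ereal l" and y: "growth_rate A y \<longlonglongrightarrow> L"
  shows "L \<le> ereal l"
proof (rule ereal_le_epsilon2)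
  fix \<epsilon> :: real assume \<epsilon>: "0 < \<epsilon>"
  \<comment> \<open>The summand 1 keeps \<open>C\<close> positive, also for \<open>y = 0\<close>, so
    that its logarithm can be split off.\<close>
  define C where "C = real CARD('n) * (\<Sum>j\<in>UNIV. norm (y $ j)) + 1"
  have C: "C \<ge> 1" unfolding C_def by (simp add: sum_nonneg)
  have "\<forall>\<^sub>F m in sequentially. \<forall>j. growth_rate A (axis j 1) m < ereal (l + \<epsilon>)"
    by (intro eventually_all_finite order_tendstoD(2)[OF e]) (use \<epsilon> in simp)
  then have ev: "\<forall>\<^sub>F m in sequentially. growth_rate A y m \<le> ereal (ln C / real m + (l + \<epsilon>))"
    using eventually_gt_at_top[of 0]
  proof eventually_elim
    case (elim m)
    let ?P = "mat_prod A m"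
    have "norm (?P *v axis j 1) \<le> exp (real m * (l + \<epsilon>))" for j
    \<comment> \<open>A vanishing image has growth rate \<open>-\<infinity>\<close> and carries no
      logarithm; the bound on its norm is then trivial.\<close>
    proof (cases "?P *v axis j 1 = 0")
      case False
      then have "1 / real m * ln (norm (?P *v axis j 1)) < l + \<epsilon>"
        using elim(1)[rule_format, of j] by (simp add: growth_rate_def)
      then have "ln (norm (?P *v axis j 1)) < real m * (l + \<epsilon>)"
        using elim(2) by (simp add: field_simps)
      then have "exp (ln (norm (?P *v axis j 1))) \<le> exp (real m * (l + \<epsilon>))" by simp
      then show ?thesis using False by simp
    qed simp
    then have "norm (?P *v y) \<le> (C - 1) * exp (real m * (l + \<epsilon>))"
      using norm_matrix_vector_mult_le[of ?P] unfolding C_def by simp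
    also have "\<dots> \<le> C * exp (real m * (l + \<epsilon>))" by simp
    finally have le: "norm (?P *v y) \<le> C * exp (real m * (l + \<epsilon>))" .
    show ?case
    proof (cases "?P *v y = 0")
      case False
      have "ln (norm (?P *v y)) \<le> ln (C * exp (real m * (l + \<epsilon>)))"
        using le False C by (subst ln_le_cancel_iff) auto
      also have "\<dots> = ln C + real m * (l + \<epsilon>)" using C by (simp add: ln_mult)
      finally show ?thesis using False elim(2) by (simp add: growth_rate_def field_simps)
    qed (simp add: growth_rate_def)
  qed
  have "(\<lambda>m. ln C / real m + (l + \<epsilon>)) \<longlonglongrightarrow> 0 + (l + \<epsilon>)"
    by (intro tendsto_intros lim_const_over_n)
  then have "(\<lambda>m. ereal (ln C / real m + (l + \<epsilon>))) \<longlonglongrightarrow> ereal (l + \<epsilon>)" by simp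
  from tendsto_le[OF _ this y ev] show "L \<le> ereal l + ereal \<epsilon>" by simp
qed

lemma largest_lyapunov_exponent_eqI:
  fixes A :: "nat \<Rightarrow> 'a::real_normed_algebra_1 ^ 'n ^ 'n"
  assumes e: "\<And>j. growth_rate A (axis j 1) \<longlonglongrightarrow> ereal l"
  shows "largest_lyapunov_exponent A = ereal l"
  unfolding largest_lyapunov_exponent_def
proof (rule antisym)
  show "Sup {L. \<exists>y. y \<noteq> 0 \<and> growth_rate A y \<longlonglongrightarrow> L} \<le> ereal l"
    using growth_rate_lim_le[OF e] by (intro Sup_least) auto
  \<comment> \<open>Every basis vector attains the supremum; \<open>undefined\<close> merely picks
    some index.\<close>
  show "ereal l \<le> Sup {L. \<exists>y. y \<noteq> 0 \<and> growth_rate A y \<longlonglongrightarrow> L}"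
    using e by (intro Sup_upper CollectI exI[of _ "axis undefined 1"]) (auto simp: axis_eq_0_iff)
qed

section \<open>Almost sure growth along a fixed vector\<close>

lemma (in prob_space) AE_growth_rate_tendsto:
  fixes X :: "nat \<Rightarrow> 'a \<Rightarrow> 'k::{real_normed_algebra_1,euclidean_space} ^ 'n ^ 'n"
  assumes ind: "indep_vars (\<lambda>_. borel) X {1..}"
    and step: "\<And>m v t. 1 \<le> m \<Longrightarrow> \<bar>t\<bar> < \<delta> \<Longrightarrow>
        (\<integral>\<^sup>+\<omega>. ennreal (norm (X m \<omega> *v v) powr t) \<partial>M) = \<kappa> t * ennreal (norm v powr t)"
    and \<kappa>: "\<kappa> 0 = 1" "\<And>t. \<bar>t\<bar> < \<delta> \<Longrightarrow> \<kappa> t \<le> ennreal (U t)"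
    and U: "U 0 = 1" "(U has_real_derivative l) (at 0)" and \<delta>: "0 < \<delta>" and y: "y \<noteq> 0"
  shows "AE \<omega> in M. growth_rate (\<lambda>m. X m \<omega>) y \<longlonglongrightarrow> ereal l"
proof -
  define P where "P m \<omega> = mat_prod (\<lambda>k. X k \<omega>) m *v y" for m \<omega>
  have [measurable]: "P m \<in> borel_measurable M" for m
  proof -
    have "(\<lambda>\<omega>. mat_prod (\<lambda>k. X k \<omega>) m) \<in> borel_measurable M"
      using ind by (intro borel_measurable_mat_prod) (auto simp: indep_vars_def)
    then show ?thesis unfolding P_def[abs_def] by measurable
  qed
  have EP: "(\<integral>\<^sup>+\<omega>. ennreal (norm (P m \<omega>) powr t) \<partial>M) = \<kappa> t ^ m * ennreal (norm y powr t)" if "\<bar>t\<bar> < \<delta>" for m t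
    unfolding P_def by (rule nn_integral_norm_mat_prod_powr[OF ind step[OF _ that]])
  \<comment> \<open>As \<open>0 powr 0 = 0\<close>, the moment of order 0 is the probability that the product does not vanish.\<close>
  have nz: "AE \<omega> in M. \<forall>m. P m \<omega> \<noteq> 0"
    unfolding AE_all_countable
  proof
    fix m
    have "emeasure M {\<omega> \<in> space M. P m \<omega> \<noteq> 0} = (\<integral>\<^sup>+\<omega>. indicator {\<omega> \<in> space M. P m \<omega> \<noteq> 0} \<omega> \<partial>M)"
      by simp
    also have "\<dots> = (\<integral>\<^sup>+\<omega>. ennreal (norm (P m \<omega>) powr 0) \<partial>M)"
      by (intro nn_integral_cong) (auto simp: indicator_def)
    also have "\<dots> = 1" using EP[of 0 m] \<delta> y by (simp add: \<kappa>)
    finally show "AE \<omega> in M. P m \<omega> \<noteq> 0"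
      by (intro AE_I_eq_1) auto
  qed
  \<comment> \<open>For \<open>t < 0\<close> the power reverses the order, so the same event then
    bounds the norm from below.\<close>
  have chernoff: "AE \<omega> in M. \<forall>\<^sub>F m in sequentially. norm (P m \<omega>) powr t < exp (t * c) ^ m"
    if t: "\<bar>t\<bar> < \<delta>" and c: "U t < exp (t * c)" for t c
  proof -
    define A where "A m = {\<omega> \<in> space M. exp (t * c) ^ m \<le> norm (P m \<omega>) powr t}" for m
    have [measurable]: "A m \<in> sets M" for m unfolding A_def by measurable
    \<comment> \<open>\<open>U t\<close> is not assumed nonnegative, while \<open>ennreal\<close>
      truncates at 0; the maximum keeps the ratio \<rho> between 0 and 1.\<close>
    define V where "V = max 0 (U t)"
    define \<rho> where "\<rho> = V / exp (t * c)"
    have V: "0 \<le> V" by (simp add: V_def)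
    have \<rho>: "0 \<le> \<rho>" "\<rho> < 1" using c by (auto simp: \<rho>_def V_def)
    have kt: "\<kappa> t \<le> ennreal V" using \<kappa>(2)[OF t] by (simp add: V_def)
    have "emeasure M (A m) \<le> ennreal (\<rho> ^ m * norm y powr t)" for m
    proof -
      let ?a = "ennreal (inverse (exp (t * c) ^ m))"
      have "A m = {\<omega> \<in> space M. 1 \<le> ?a * ennreal (norm (P m \<omega>) powr t)}"
        unfolding A_def by (subst ennreal_mult'[symmetric]) (auto simp: field_simps ennreal_1[symmetric] simp del: ennreal_1)
      then have "emeasure M (A m) \<le> ?a * (\<integral>\<^sup>+\<omega>. ennreal (norm (P m \<omega>) powr t) * indicator (space M) \<omega> \<partial>M)"
        using nn_integral_Markov_inequality[of "\<lambda>\<omega>. ennreal (norm (P m \<omega>) powr t)" "space M" M ?a]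
        by simp
      also have "(\<integral>\<^sup>+\<omega>. ennreal (norm (P m \<omega>) powr t) * indicator (space M) \<omega> \<partial>M) = (\<integral>\<^sup>+\<omega>. ennreal (norm (P m \<omega>) powr t) \<partial>M)"
        by (intro nn_integral_cong) simp
      also have "\<dots> = \<kappa> t ^ m * ennreal (norm y powr t)" by (rule EP[OF t])
      also have "?a * \<dots> \<le> ?a * (ennreal V ^ m * ennreal (norm y powr t))"
        by (intro mult_left_mono mult_right_mono power_mono kt) auto
      also have "\<dots> = ennreal (\<rho> ^ m * norm y powr t)"
        using V by (simp add: ennreal_power ennreal_mult'[symmetric] \<rho>_def power_divide divide_inverse power_mult_distrib power_inverse mult_ac)
      finally show ?thesis .
    qed
    note bd = this
    have "summable (\<lambda>m. measure M (A m))"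
    proof (rule summable_comparison_test')
      show "summable (\<lambda>m. \<rho> ^ m * norm y powr t)"
        using \<rho> by (intro summable_mult2 summable_geometric) simp
      show "norm (measure M (A m)) \<le> \<rho> ^ m * norm y powr t" for m
        using bd[of m] \<rho> by (simp add: emeasure_eq_measure)
    qed
    then have "AE \<omega> in M. \<forall>\<^sub>F m in sequentially. \<omega> \<in> space M - A m"
      by (intro borel_cantelli_AE1) (auto simp: emeasure_eq_measure)
    then show ?thesis
      by (rule AE_mp) (auto intro!: AE_I2 elim!: eventually_mono simp: A_def)
  qed
  \<comment> \<open>The product form covers both sides: for \<open>c > l\<close> the norm is
    eventually below \<open>exp (real m * c)\<close>, for \<open>c < l\<close> eventually above
    it.\<close>
  have tail: "AE \<omega> in M. \<forall>\<^sub>F m in sequentially. 0 < (c - l) * (real m * c - ln (norm (P m \<omega>)))"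
    if ne: "c \<noteq> l" for c
  proof -
    obtain t where t: "\<bar>t\<bar> < \<delta>" "U t < exp (t * c)" "0 < t * (c - l)"
      by (rule exists_powr_lt_exp[OF U \<delta> ne])
    show ?thesis using chernoff[OF t(1,2)] nz
    proof eventually_elim
      case (elim \<omega>)
      from elim(1) show ?case
      proof eventually_elim
        case (elim m)
        have "P m \<omega> \<noteq> 0" using \<open>\<forall>m. P m \<omega> \<noteq> 0\<close> by blast
        then have "exp (t * ln (norm (P m \<omega>))) < exp (real m * (t * c))"
          using elim by (simp add: powr_def exp_of_nat_mult)
        then have "0 < t * (real m * c - ln (norm (P m \<omega>)))" by (simp add: algebra_simps)
        with t(3) show ?case by (auto simp: zero_less_mult_iff)
      qed
    qed
  qed
  \<comment> \<open>The radii \<open>1 / real (Suc k)\<close> keep the number of exceptional null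
    sets countable.\<close>
  have "AE \<omega> in M. \<forall>k. \<forall>\<^sub>F m in sequentially. ln (norm (P m \<omega>)) < real m * (l + 1 / real (Suc k))
      \<and> real m * (l - 1 / real (Suc k)) < ln (norm (P m \<omega>))"
    unfolding AE_all_countable
  proof
    fix k
    define r where "r = 1 / real (Suc k)"
    have r: "0 < r" by (simp add: r_def)
    have "AE \<omega> in M. \<forall>\<^sub>F m in sequentially. 0 < (l + r - l) * (real m * (l + r) - ln (norm (P m \<omega>)))"
      "AE \<omega> in M. \<forall>\<^sub>F m in sequentially. 0 < (l - r - l) * (real m * (l - r) - ln (norm (P m \<omega>)))"
      using r by (intro tail; simp)+
    then show "AE \<omega> in M. \<forall>\<^sub>F m in sequentially. ln (norm (P m \<omega>)) < real m * (l + 1 / real (Suc k))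
      \<and> real m * (l - 1 / real (Suc k)) < ln (norm (P m \<omega>))"
      unfolding r_def[symmetric]
    proof eventually_elim
      case (elim \<omega>)
      then show ?case by eventually_elim (use r in \<open>auto simp: zero_less_mult_iff mult_less_0_iff\<close>)
    qed
  qed
  then show ?thesis using nz
  proof eventually_elim
    case (elim \<omega>)
    have "(\<lambda>m. 1 / real m * ln (norm (P m \<omega>))) \<longlonglongrightarrow> l"
    proof (rule LIMSEQ_I)
      fix r :: real assume "0 < r"
      then obtain k where k: "1 / real (Suc k) < r"
        using nat_approx_posE by blast
      have "\<forall>\<^sub>F m in sequentially. norm (1 / real m * ln (norm (P m \<omega>)) - l) < r"
        using elim(1)[rule_format, of k] eventually_gt_at_top[of 0]
      proof eventually_elim
        case (elim m)
        then have "1 / real m * ln (norm (P m \<omega>)) < l + 1 / real (Suc k)"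
          "l - 1 / real (Suc k) < 1 / real m * ln (norm (P m \<omega>))"
          by (simp_all add: field_simps del: of_nat_Suc)
        with k show ?case by (simp del: of_nat_Suc)
      qed
      then show "\<exists>m0. \<forall>m\<ge>m0. norm (1 / real m * ln (norm (P m \<omega>)) - l) < r"
        by (simp add: eventually_sequentially)
    qed
    moreover have "growth_rate (\<lambda>m. X m \<omega>) y = (\<lambda>m. ereal (1 / real m * ln (norm (P m \<omega>))))"
      using elim(2) by (auto simp: growth_rate_def P_def)
    ultimately show ?case by simp
  qed
qed

lemma (in prob_space) has_largest_lyapunov_exponentI:
  fixes X :: "nat \<Rightarrow> 'a \<Rightarrow> 'k::{real_normed_algebra_1,euclidean_space} ^ 'n ^ 'n"
  assumes "indep_vars (\<lambda>_. borel) X {1..}"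
    and "\<And>m v t. 1 \<le> m \<Longrightarrow> \<bar>t\<bar> < \<delta> \<Longrightarrow>
        (\<integral>\<^sup>+\<omega>. ennreal (norm (X m \<omega> *v v) powr t) \<partial>M) = \<kappa> t * ennreal (norm v powr t)"
    and "\<kappa> 0 = 1" "\<And>t. \<bar>t\<bar> < \<delta> \<Longrightarrow> \<kappa> t \<le> ennreal (U t)"
    and "U 0 = 1" "(U has_real_derivative l) (at 0)" and "0 < \<delta>"
  shows "has_largest_lyapunov_exponent M X l"
  unfolding has_largest_lyapunov_exponent_def
proof (intro conjI allI impI)
  have lim: "AE \<omega> in M. growth_rate (\<lambda>m. X m \<omega>) y \<longlonglongrightarrow> ereal l" if "y \<noteq> 0" for y
    by (rule AE_growth_rate_tendsto[where \<delta>=\<delta> and \<kappa>=\<kappa> and U=U]) (use assms that in auto)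
  show "AE \<omega> in M. convergent (growth_rate (\<lambda>m. X m \<omega>) y)" if "y \<noteq> 0" for y
    using lim[OF that] by (rule AE_mp) (auto intro!: AE_I2 convergentI)
  have "AE \<omega> in M. \<forall>j. growth_rate (\<lambda>m. X m \<omega>) (axis j 1) \<longlonglongrightarrow> ereal l"
    unfolding AE_all_countable using lim by (auto simp: axis_eq_0_iff)
  then show "AE \<omega> in M. largest_lyapunov_exponent (\<lambda>m. X m \<omega>) = ereal l"
    by (rule AE_mp) (auto intro!: AE_I2 largest_lyapunov_exponent_eqI)
qed

section \<open>Gaussian matrices\<close>

text \<open>\<open>Z\<close> is tied to the block functions only by a pointwise equation, so that
  the variables of interest keep their natural form.\<close>

lemma (in prob_space) indep_vars_group:
  assumes ind: "indep_vars (\<lambda>_. N) X I" and K: "\<And>j. j \<in> L \<Longrightarrow> K j \<subseteq> I" "disjoint_family_on K L"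
    and Y: "\<And>j. j \<in> L \<Longrightarrow> Y j \<in> measurable (PiM (K j) (\<lambda>_. N)) N'"
    and Z: "\<And>j \<omega>. j \<in> L \<Longrightarrow> Z j \<omega> = Y j (restrict (\<lambda>k. X k \<omega>) (K j))"
  shows "indep_vars (\<lambda>_. N') Z L"
proof -
  have "indep_vars (\<lambda>_. N') (\<lambda>j \<omega>. Y j (restrict (\<lambda>k. X k \<omega>) (K j))) L"
    by (rule indep_vars_compose2[OF indep_vars_restrict[OF ind K] Y])
  then show ?thesis
    by (rule indep_vars_cong[THEN iffD1, rotated -1]) (auto simp: Z)
qed

lemma (in prob_space) indep_vars_reindex:
  assumes ind: "indep_vars (\<lambda>_. N) X I" and h: "inj_on h L" "h ` L \<subseteq> I"
  shows "indep_vars (\<lambda>_. N) (\<lambda>j. X (h j)) L"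
  by (rule indep_vars_group[OF ind, where K="\<lambda>j. {h j}" and Y="\<lambda>j f. f (h j)"])
    (use h in \<open>auto simp: disjoint_family_on_def inj_on_def\<close>)

text \<open>Independence makes both joint laws products of their marginals.\<close>

lemma (in prob_space) distr_indep_vars_eq:
  assumes X: "indep_vars (\<lambda>_. N) X I" and Y: "indep_vars (\<lambda>_. N) Y I" and I: "I \<noteq> {}"
    and eq: "\<And>i. i \<in> I \<Longrightarrow> distr M N (X i) = distr M N (Y i)"
  shows "distr M (PiM I (\<lambda>_. N)) (\<lambda>\<omega>. \<lambda>i\<in>I. X i \<omega>) = distr M (PiM I (\<lambda>_. N)) (\<lambda>\<omega>. \<lambda>i\<in>I. Y i \<omega>)"
proof -
  have "distr M (PiM I (\<lambda>_. N)) (\<lambda>\<omega>. \<lambda>i\<in>I. X i \<omega>) = (\<Pi>\<^sub>M i\<in>I. distr M N (X i))"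
    using X I indep_vars_iff_distr_eq_PiM'[where I=I and M'="\<lambda>_. N" and X=X] by (auto simp: indep_vars_def)
  also have "\<dots> = (\<Pi>\<^sub>M i\<in>I. distr M N (Y i))" by (intro PiM_cong eq refl)
  also have "\<dots> = distr M (PiM I (\<lambda>_. N)) (\<lambda>\<omega>. \<lambda>i\<in>I. Y i \<omega>)"
    using Y I indep_vars_iff_distr_eq_PiM'[where I=I and M'="\<lambda>_. N" and X=Y] by (auto simp: indep_vars_def)
  finally show ?thesis .
qed

section \<open>Coordinates and entries of a Gaussian matrix\<close>

abbreviation coord :: "('w \<Rightarrow> 'a::euclidean_space ^ 'n ^ 'm) \<Rightarrow> 'm \<times> 'n \<times> 'a \<Rightarrow> 'w \<Rightarrow> real" where
  "coord G k \<omega> \<equiv> inner (G \<omega> $ fst k $ fst (snd k)) (snd (snd k))"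

lemma (in prob_space) std_gaussian_matrix_coord:
  assumes "std_gaussian_matrix M G"
  shows "indep_vars (\<lambda>_. borel) (coord G) (UNIV \<times> UNIV \<times> Basis)"
    and "b \<in> Basis \<Longrightarrow> distributed M lborel (coord G (i, j, b)) std_normal_density"
  using assms by (simp_all add: std_gaussian_matrix_def case_prod_unfold)

lemma (in prob_space) std_gaussian_matrix_measurable:
  fixes G :: "'a \<Rightarrow> 'k::euclidean_space ^ 'n ^ 'm"
  assumes "std_gaussian_matrix M G"
  shows "G \<in> borel_measurable M"
proof (subst borel_measurable_euclidean_space, rule ballI)
  fix c :: "'k ^ 'n ^ 'm" assume "c \<in> Basis"
  then obtain i j b where b: "b \<in> Basis" and c: "c = axis i (axis j b)"
    unfolding Basis_vec_def by auto
  show "(\<lambda>\<omega>. inner (G \<omega>) c) \<in> borel_measurable M"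
    using distributed_measurable[OF std_gaussian_matrix_coord(2)[OF assms b, of i j]]
    by (simp add: c inner_axis)
qed

lemma (in prob_space) std_gaussian_matrix_entries:
  fixes G :: "'a \<Rightarrow> 'k::euclidean_space ^ 'n ^ 'm"
  assumes G: "std_gaussian_matrix M G"
  shows "indep_vars (\<lambda>_. borel) (\<lambda>p \<omega>. G \<omega> $ fst p $ snd p) UNIV"
    and "distr M borel (\<lambda>\<omega>. G \<omega> $ i $ j) = std_gaussian"
proof -
  note ind = std_gaussian_matrix_coord(1)[OF G]
  show "indep_vars (\<lambda>_. borel) (\<lambda>p \<omega>. G \<omega> $ fst p $ snd p) UNIV"
  proof (rule indep_vars_group[OF ind, where K="\<lambda>p. {fst p} \<times> {snd p} \<times> Basis"
        and Y="\<lambda>p f. \<Sum>b\<in>Basis. f (fst p, snd p, b) *\<^sub>R b"])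
    show "(\<lambda>f. \<Sum>b\<in>Basis. f (fst p, snd p, b) *\<^sub>R b) \<in> borel_measurable (PiM ({fst p} \<times> {snd p} \<times> (Basis :: 'k set)) (\<lambda>_. borel))"
      for p :: "'m \<times> 'n"
      by measurable
  qed (auto simp: disjoint_family_on_def euclidean_representation)
  let ?g = "\<lambda>\<omega>. \<lambda>b\<in>Basis. coord G (i, j, b) \<omega>"
  have law: "distr M borel (coord G (i, j, b)) = std_normal" if "b \<in> Basis" for b
    using distributed_distr_eq_density[OF std_gaussian_matrix_coord(2)[OF G that, of i j]]
    by (subst distr_cong[of M M borel lborel _ "coord G (i, j, b)"]) auto
  have ib: "indep_vars (\<lambda>_. borel) (\<lambda>b. coord G (i, j, b)) Basis"
    by (rule indep_vars_reindex[OF ind]) (auto simp: inj_on_def)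
  then have rv: "random_variable borel (coord G (i, j, b))" if "b \<in> Basis" for b
    using that unfolding indep_vars_def by blast
  have "distr M (PiM Basis (\<lambda>_. borel)) ?g = (\<Pi>\<^sub>M b\<in>Basis. distr M borel (coord G (i, j, b)))"
    using ib indep_vars_iff_distr_eq_PiM'[where I=Basis and M'="\<lambda>_. borel" and X="\<lambda>b. coord G (i, j, b)"] rv by simp
  also have "\<dots> = (\<Pi>\<^sub>M b\<in>Basis. std_normal)" by (intro PiM_cong refl law)
  finally have g: "distr M (PiM Basis (\<lambda>_. borel)) ?g = (\<Pi>\<^sub>M b\<in>Basis. std_normal)" .
  have mg: "?g \<in> measurable M (PiM Basis (\<lambda>_. borel))"
    using rv by (intro measurable_restrict) auto
  have "std_gaussian = distr (distr M (PiM Basis (\<lambda>_. borel)) ?g) borel (\<lambda>f. \<Sum>b\<in>Basis. f b *\<^sub>R (b::'k))"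
    unfolding g std_gaussian_def ..
  also have "\<dots> = distr M borel (\<lambda>\<omega>. G \<omega> $ i $ j)"
    by (subst distr_distr[OF _ mg]) (auto simp: o_def euclidean_representation)
  finally show "distr M borel (\<lambda>\<omega>. G \<omega> $ i $ j) = std_gaussian" ..
qed

text \<open>Each entry has an isotropic law, so right multiplication by a scalar acts on it like multiplication
  by the norm of that scalar.\<close>

lemma (in prob_space) nn_integral_std_gaussian_matrix_mult:
  fixes G :: "'a \<Rightarrow> 'k::{real_normed_div_algebra,euclidean_space} ^ 'n ^ 'm"
  assumes G: "std_gaussian_matrix M G"
    and F: "F \<in> borel_measurable (PiM UNIV (\<lambda>_. borel))"
  shows "(\<integral>\<^sup>+\<omega>. F (\<lambda>p. G \<omega> $ fst p $ snd p * v $ snd p) \<partial>M) =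
    (\<integral>\<^sup>+\<omega>. F (\<lambda>p. norm (v $ snd p) *\<^sub>R G \<omega> $ fst p $ snd p) \<partial>M)"
proof -
  note ind = std_gaussian_matrix_entries(1)[OF G]
  have [measurable]: "G \<in> borel_measurable M" by (rule std_gaussian_matrix_measurable[OF G])
  have mult [measurable]: "(\<lambda>x. x * v $ j) \<in> borel_measurable borel" for j
    by (intro borel_measurable_continuous_onI continuous_intros)
  have entry [measurable]: "(\<lambda>\<omega>. G \<omega> $ i $ j) \<in> borel_measurable M" for i j
    using conjunct1[OF ind[unfolded indep_vars_def], THEN bspec, of "(i, j)"] by simp
  let ?X = "\<lambda>p \<omega>. G \<omega> $ fst p $ snd p * v $ snd p" and ?Y = "\<lambda>p \<omega>. norm (v $ snd p) *\<^sub>R G \<omega> $ fst p $ snd p"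
  \<comment> \<open>Entrywise equality of laws is lifted to the whole family of entries by
    independence, so that an arbitrary functional \<open>F\<close> can be integrated.\<close>
  have eq: "distr M (PiM UNIV (\<lambda>_. borel)) (\<lambda>\<omega>. \<lambda>p\<in>UNIV. ?X p \<omega>) = distr M (PiM UNIV (\<lambda>_. borel)) (\<lambda>\<omega>. \<lambda>p\<in>UNIV. ?Y p \<omega>)"
  proof (rule distr_indep_vars_eq)
    show "indep_vars (\<lambda>_. borel) ?X UNIV"
      by (rule indep_vars_compose2[OF ind, of "\<lambda>p x. x * v $ snd p"]) measurable
    show "indep_vars (\<lambda>_. borel) ?Y UNIV"
      by (rule indep_vars_compose2[OF ind, of "\<lambda>p x. norm (v $ snd p) *\<^sub>R x"]) measurable
    fix p :: "'m \<times> 'n"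
    have "distr M borel (?X p) = distr (distr M borel (\<lambda>\<omega>. G \<omega> $ fst p $ snd p)) borel (\<lambda>x. x * v $ snd p)"
      by (subst distr_distr) (auto simp: o_def)
    also have "\<dots> = distr (distr M borel (\<lambda>\<omega>. G \<omega> $ fst p $ snd p)) borel (\<lambda>x. norm (v $ snd p) *\<^sub>R x)"
      by (simp only: std_gaussian_matrix_entries(2)[OF G] distr_std_gaussian_mult_right)
    also have "\<dots> = distr M borel (?Y p)"
      by (subst distr_distr) (auto simp: o_def)
    finally show "distr M borel (?X p) = distr M borel (?Y p)" .
  qed simp
  have "(\<lambda>\<omega>. \<lambda>p\<in>UNIV. ?X p \<omega>) \<in> measurable M (PiM UNIV (\<lambda>_. borel))"
    "(\<lambda>\<omega>. \<lambda>p\<in>UNIV. ?Y p \<omega>) \<in> measurable M (PiM UNIV (\<lambda>_. borel))"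
    by (intro measurable_restrict; measurable)+
  moreover have "F \<in> borel_measurable (distr M (PiM UNIV (\<lambda>_. borel)) T)" for T
    using F by simp
  ultimately show ?thesis
    using nn_integral_distr[of "\<lambda>\<omega>. \<lambda>p\<in>UNIV. ?X p \<omega>" M "PiM UNIV (\<lambda>_. borel)" F]
      nn_integral_distr[of "\<lambda>\<omega>. \<lambda>p\<in>UNIV. ?Y p \<omega>" M "PiM UNIV (\<lambda>_. borel)" F] eq
    by (simp add: restrict_UNIV)
qed

text \<open>The coefficients are real, so each \<open>Z (i, b)\<close> uses only the coordinates
  with row \<open>i\<close> and unit \<open>b\<close>: distinct indices read disjoint sets, and the
  unit sum of squares preserves the variance.\<close>

lemma (in prob_space) std_gaussian_matrix_row_combination:
  fixes G :: "'a \<Rightarrow> 'k::euclidean_space ^ 'n ^ 'm"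
  assumes G: "std_gaussian_matrix M G" and r: "(\<Sum>j\<in>UNIV. (r j)\<^sup>2) = 1"
  defines "Z \<equiv> \<lambda>q \<omega>. \<Sum>j\<in>UNIV. r j * coord G (fst q, j, snd q) \<omega>"
  shows "indep_vars (\<lambda>_. borel) Z (UNIV \<times> Basis)"
    and "b \<in> Basis \<Longrightarrow> distributed M lborel (Z (i, b)) std_normal_density"
proof -
  note ind = std_gaussian_matrix_coord(1)[OF G]
  show "indep_vars (\<lambda>_. borel) Z (UNIV \<times> Basis)"
  proof (rule indep_vars_group[OF ind, where K="\<lambda>q. {fst q} \<times> UNIV \<times> {snd q}"
        and Y="\<lambda>q f. \<Sum>j\<in>UNIV. r j * f (fst q, j, snd q)"])
    show "(\<lambda>f. \<Sum>j\<in>UNIV. r j * f (fst q, j, snd q)) \<in> borel_measurable (PiM ({fst q} \<times> UNIV \<times> {snd q}) (\<lambda>_. borel))"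
      for q :: "'m \<times> 'k"
      by measurable
  qed (auto simp: disjoint_family_on_def Z_def)
  assume b: "b \<in> Basis"
  \<comment> \<open>Terms with zero coefficient are dropped because the sum rule for normal
    variables asks for positive standard deviations.\<close>
  define J where "J = {j. r j \<noteq> 0}"
  have sum_J: "(\<Sum>j\<in>UNIV. f (r j) j) = (\<Sum>j\<in>J. f (r j) j)" if "\<And>j. f 0 j = 0" for f :: "real \<Rightarrow> 'n \<Rightarrow> real"
    by (rule sum.mono_neutral_right) (auto simp: J_def that)
  have "J \<noteq> {}" using r sum_J[of "\<lambda>x _. x\<^sup>2"] by auto
  have "indep_vars (\<lambda>_. borel) (\<lambda>j. coord G (i, j, b)) J"
    by (rule indep_vars_reindex[OF ind]) (auto simp: inj_on_def b)
  then have indJ: "indep_vars (\<lambda>_. borel) (\<lambda>j \<omega>. r j * coord G (i, j, b) \<omega>) J"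
    by (rule indep_vars_compose2[where Y="\<lambda>j x. r j * x"]) measurable
  have "distributed M lborel (\<lambda>\<omega>. \<Sum>j\<in>J. r j * coord G (i, j, b) \<omega>)
      (normal_density (\<Sum>j\<in>J. 0) (sqrt (\<Sum>j\<in>J. \<bar>r j\<bar>\<^sup>2)))"
  proof (rule sum_indep_normal[OF _ \<open>J \<noteq> {}\<close> indJ])
    show "distributed M lborel (\<lambda>\<omega>. r j * coord G (i, j, b) \<omega>) (normal_density 0 \<bar>r j\<bar>)" if "j \<in> J" for j
      using normal_density_affine[OF std_gaussian_matrix_coord(2)[OF G b, of i j], of "r j" 0] that
      by (simp add: J_def)
  qed (auto simp: J_def)
  also have "(\<lambda>\<omega>. \<Sum>j\<in>J. r j * coord G (i, j, b) \<omega>) = Z (i, b)"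
    unfolding Z_def fst_conv snd_conv by (intro ext sum_J[symmetric]) simp
  also have "(\<Sum>j\<in>J. \<bar>r j\<bar>\<^sup>2) = 1"
    using r sum_J[of "\<lambda>x _. x\<^sup>2"] by simp
  finally show "distributed M lborel (Z (i, b)) std_normal_density" by simp
qed

text \<open>Splitting the rows by \<open>S\<close> leaves two independent half sums of squares with
  weights \<open>1 / p\<close> and \<open>1 / q\<close>: the 2 in the weights is the halving that
  produces Gamma laws of unit scale.\<close>

lemma (in prob_space) nn_integral_weighted_row_combination_powr:
  fixes G :: "'a \<Rightarrow> 'k::euclidean_space ^ 'n ^ 'm"
  assumes G: "std_gaussian_matrix M G" and r: "(\<Sum>j\<in>UNIV. (r j)\<^sup>2) = 1"
    and c: "\<And>i. i \<in> S \<Longrightarrow> c i = 1 / (2 * p)" "\<And>i. i \<notin> S \<Longrightarrow> c i = 1 / (2 * q)"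
    and pq: "0 < p" "0 < q" and S: "S \<noteq> {}" "- S \<noteq> {}"
    and a: "a = real DIM('k) * real (card S) / 2" and b: "b = real DIM('k) * real (card (- S)) / 2"
    and t: "0 < a + b + t"
  shows "(\<integral>\<^sup>+\<omega>. ennreal ((\<Sum>i\<in>UNIV. c i * (norm (\<Sum>j\<in>UNIV. r j *\<^sub>R G \<omega> $ i $ j))\<^sup>2) powr t) \<partial>M) =
    ennreal (Gamma (a + b + t) / Gamma (a + b)) *
    (\<integral>\<^sup>+u. ennreal (beta_density a b u * (u / p + (1 - u) / q) powr t) \<partial>lborel)"
proof -
  define Z where "Z q \<omega> = (\<Sum>j\<in>UNIV. r j * coord G (fst q, j, snd q) \<omega>)" for q \<omega>
  have Z: "indep_vars (\<lambda>_. borel) Z (UNIV \<times> Basis)"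
    "b \<in> Basis \<Longrightarrow> distributed M lborel (Z (i, b)) std_normal_density" for i b
    using std_gaussian_matrix_row_combination[OF G r] by (simp_all add: Z_def[abs_def])
  define A where "A T \<omega> = (\<Sum>q\<in>T \<times> Basis. (Z q \<omega>)\<^sup>2 / 2)" for T \<omega>
  have row: "(norm (\<Sum>j\<in>UNIV. r j *\<^sub>R G \<omega> $ i $ j))\<^sup>2 = (\<Sum>b\<in>Basis. (Z (i, b) \<omega>)\<^sup>2)" for i \<omega>
    unfolding power2_norm_eq_inner
    by (subst euclidean_inner) (simp add: Z_def inner_sum_left power2_eq_square)
  have half: "(\<Sum>i\<in>T. c i * (\<Sum>b\<in>Basis. (Z (i, b) \<omega>)\<^sup>2)) = A T \<omega> / x"
    if "\<And>i. i \<in> T \<Longrightarrow> c i = 1 / (2 * x)" for T x \<omega>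
  proof -
    have "(\<Sum>i\<in>T. c i * (\<Sum>b\<in>Basis. (Z (i, b) \<omega>)\<^sup>2)) = (\<Sum>i\<in>T. \<Sum>b\<in>Basis. (Z (i, b) \<omega>)\<^sup>2 / 2 / x)"
      using that by (intro sum.cong refl) (simp add: sum_divide_distrib)
    also have "\<dots> = (\<Sum>q\<in>T \<times> Basis. (Z q \<omega>)\<^sup>2 / 2 / x)"
      by (subst sum.cartesian_product) (simp add: case_prod_unfold)
    also have "\<dots> = A T \<omega> / x" unfolding A_def by (rule sum_divide_distrib[symmetric])
    finally show ?thesis .
  qed
  have total: "(\<Sum>i\<in>UNIV. c i * (norm (\<Sum>j\<in>UNIV. r j *\<^sub>R G \<omega> $ i $ j))\<^sup>2) = A S \<omega> / p + A (- S) \<omega> / q" for \<omega>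
  proof -
    have "(\<Sum>i\<in>UNIV. c i * (\<Sum>b\<in>Basis. (Z (i, b) \<omega>)\<^sup>2)) =
      (\<Sum>i\<in>S. c i * (\<Sum>b\<in>Basis. (Z (i, b) \<omega>)\<^sup>2)) + (\<Sum>i\<in>- S. c i * (\<Sum>b\<in>Basis. (Z (i, b) \<omega>)\<^sup>2))"
      by (subst sum.union_disjoint[symmetric]) (auto simp: Compl_partition)
    also have "\<dots> = A S \<omega> / p + A (- S) \<omega> / q"
      using c by (intro arg_cong2[where f="(+)"] half) auto
    finally show ?thesis by (simp only: row)
  qed
  have law: "distributed M lborel (A T) (gamma_density (real DIM('k) * real (card T) / 2))" if "T \<noteq> {}" for T
  proof -
    have "indep_vars (\<lambda>_. borel) Z (T \<times> Basis)" using Z(1) by (rule indep_vars_subset) auto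
    then have "distributed M lborel (A T) (gamma_density (real (card (T \<times> (Basis :: 'k set))) / 2))"
      unfolding A_def[abs_def] using that Z(2)
      by (intro distributed_half_sum_squares_normal) auto
    then show ?thesis by (simp add: card_cartesian_product mult.commute)
  qed
  have ind: "indep_var borel (A S) borel (A (- S))"
  proof -
    have "indep_var borel ((\<lambda>f. \<Sum>q\<in>S \<times> Basis. (f q)\<^sup>2 / 2) \<circ> (\<lambda>\<omega>. restrict (\<lambda>q. Z q \<omega>) (S \<times> Basis)))
      borel ((\<lambda>f. \<Sum>q\<in>(- S) \<times> Basis. (f q)\<^sup>2 / 2) \<circ> (\<lambda>\<omega>. restrict (\<lambda>q. Z q \<omega>) ((- S) \<times> Basis)))"
      by (rule indep_var_compose[OF indep_var_restrict[OF Z(1)]]) auto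
    then show ?thesis by (simp add: comp_def A_def[abs_def])
  qed
  have "0 < a" "0 < b" using S by (auto simp: a b card_gt_0_iff)
  from nn_integral_gamma_combination_powr[OF law[OF S(1), folded a] law[OF S(2), folded b] ind this pq t]
  show ?thesis by (simp add: total)
qed

section \<open>Moments of a single factor\<close>

lemma norm_diag_mat_mult_vector_square:
  fixes A :: "'k::real_normed_div_algebra ^ 'n ^ 'n"
  shows "(norm ((diag_mat s ** A) *v v))\<^sup>2 = (\<Sum>i\<in>UNIV. (s i)\<^sup>2 * (norm (\<Sum>j\<in>UNIV. A $ i $ j * v $ j))\<^sup>2)"
proof -
  have "((diag_mat s ** A) *v v) $ i = of_real (s i) * (\<Sum>j\<in>UNIV. A $ i $ j * v $ j)" for i
    by (simp add: matrix_vector_mult_def matrix_matrix_mult_def diag_mat_def if_distrib[of "\<lambda>x. x * _"]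
        sum_distrib_left mult.assoc cong: if_cong)
  then show ?thesis
    by (simp add: norm_vec_def L2_set_def sum_nonneg norm_mult power_mult_distrib)
qed

lemma (in prob_space) nn_integral_norm_diag_gaussian_powr:
  fixes G :: "'a \<Rightarrow> 'k::{real_normed_div_algebra,euclidean_space} ^ 'n ^ 'n"
  assumes G: "std_gaussian_matrix M G"
    and s: "\<And>i. i \<in> S \<Longrightarrow> (s i)\<^sup>2 = 1 / (2 * p)" "\<And>i. i \<notin> S \<Longrightarrow> (s i)\<^sup>2 = 1 / (2 * q)"
    and pq: "0 < p" "0 < q" and S: "S \<noteq> {}" "- S \<noteq> {}"
    and a: "a = real DIM('k) * real (card S) / 2" and b: "b = real DIM('k) * real (card (- S)) / 2"
    and t: "0 < a + b + t / 2"
  shows "(\<integral>\<^sup>+\<omega>. ennreal (norm ((diag_mat s ** G \<omega>) *v v) powr t) \<partial>M) =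
    ennreal (Gamma (a + b + t / 2) / Gamma (a + b)) *
    (\<integral>\<^sup>+u. ennreal (beta_density a b u * (u / p + (1 - u) / q) powr (t / 2)) \<partial>lborel) * ennreal (norm v powr t)"
\<comment> \<open>Since \<open>0 powr t = 0\<close> for every \<open>t\<close>, negative ones
  included, the identity also holds for \<open>v = 0\<close>; the induction over the product applies
  it to vectors that might vanish.\<close>
proof (cases "v = 0")
  case False
  define r where "r j = norm (v $ j) / norm v" for j
  have v2: "(norm v)\<^sup>2 = (\<Sum>j\<in>UNIV. (norm (v $ j))\<^sup>2)"
    by (simp add: norm_vec_def L2_set_def sum_nonneg)
  have r: "(\<Sum>j\<in>UNIV. (r j)\<^sup>2) = 1"
    using False by (simp add: r_def power_divide v2[symmetric] flip: sum_divide_distrib)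
  have sq: "x powr t = (x\<^sup>2) powr (t / 2)" if "0 \<le> x" for x :: real
    using that by (cases "x = 0") (auto simp: powr_def ln_realpow)
  define F where "F f = ennreal ((\<Sum>i\<in>UNIV. (s i)\<^sup>2 * (norm (\<Sum>j\<in>UNIV. f (i, j)))\<^sup>2) powr (t / 2))"
    for f :: "'n \<times> 'n \<Rightarrow> 'k"
  have F: "F \<in> borel_measurable (PiM UNIV (\<lambda>_. borel))"
    unfolding F_def[abs_def] by measurable
  let ?W = "\<lambda>\<omega>. \<Sum>i\<in>UNIV. (s i)\<^sup>2 * (norm (\<Sum>j\<in>UNIV. r j *\<^sub>R G \<omega> $ i $ j))\<^sup>2"
  have [measurable]: "G \<in> borel_measurable M" by (rule std_gaussian_matrix_measurable[OF G])
  have entry [measurable]: "(\<lambda>\<omega>. G \<omega> $ i $ j) \<in> borel_measurable M" for i j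
    using conjunct1[OF std_gaussian_matrix_entries(1)[OF G, unfolded indep_vars_def], THEN bspec, of "(i, j)"] by simp
  have "(\<integral>\<^sup>+\<omega>. ennreal (norm ((diag_mat s ** G \<omega>) *v v) powr t) \<partial>M) = (\<integral>\<^sup>+\<omega>. F (\<lambda>p. G \<omega> $ fst p $ snd p * v $ snd p) \<partial>M)"
    by (simp add: sq norm_diag_mat_mult_vector_square F_def)
  also have "\<dots> = (\<integral>\<^sup>+\<omega>. F (\<lambda>p. norm (v $ snd p) *\<^sub>R G \<omega> $ fst p $ snd p) \<partial>M)"
    by (rule nn_integral_std_gaussian_matrix_mult[OF G F])
  also have "\<dots> = (\<integral>\<^sup>+\<omega>. ennreal (?W \<omega> powr (t / 2)) * ennreal (norm v powr t) \<partial>M)"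
  proof (rule nn_integral_cong)
    fix \<omega>
    have "norm (v $ j) *\<^sub>R G \<omega> $ i $ j = norm v *\<^sub>R (r j *\<^sub>R G \<omega> $ i $ j)" for i j
      using False by (simp add: r_def)
    then have "(\<Sum>j\<in>UNIV. norm (v $ j) *\<^sub>R G \<omega> $ i $ j) = norm v *\<^sub>R (\<Sum>j\<in>UNIV. r j *\<^sub>R G \<omega> $ i $ j)" for i
      by (simp only: scaleR_sum_right)
    then have "(\<Sum>i\<in>UNIV. (s i)\<^sup>2 * (norm (\<Sum>j\<in>UNIV. norm (v $ j) *\<^sub>R G \<omega> $ i $ j))\<^sup>2) = ?W \<omega> * (norm v)\<^sup>2"
      by (simp add: power_mult_distrib sum_distrib_left sum_distrib_right mult_ac)
    moreover have "0 \<le> ?W \<omega>" by (simp add: sum_nonneg)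
    ultimately show "F (\<lambda>p. norm (v $ snd p) *\<^sub>R G \<omega> $ fst p $ snd p) = ennreal (?W \<omega> powr (t / 2)) * ennreal (norm v powr t)"
      by (simp add: F_def powr_mult sq ennreal_mult')
  qed
  also have "\<dots> = (\<integral>\<^sup>+\<omega>. ennreal (?W \<omega> powr (t / 2)) \<partial>M) * ennreal (norm v powr t)"
    by (intro nn_integral_multc) measurable
  finally show ?thesis
    using nn_integral_weighted_row_combination_powr[OF G r s pq S a b t] by simp
qed simp

text \<open>The three number systems are instances, with \<beta> as \<open>DIM('k)\<close>; of the
  two blocks of rows only the cardinalities enter the result.\<close>

theorem gaussian_product_largest_lyapunov_exponent:
  fixes M :: "'w measure" and M' :: "'v measure"
    and G :: "'v \<Rightarrow> 'k::{real_normed_div_algebra,euclidean_space} ^ 'n ^ 'n"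
  assumes M: "prob_space M" and M': "prob_space M'"
    and G: "std_gaussian_matrix M' G" and X: "iid_copies M X M' (\<lambda>\<omega>. diag_mat s ** G \<omega>)"
    and s: "\<And>i. i \<in> S \<Longrightarrow> (s i)\<^sup>2 = 1 / (2 * p)" "\<And>i. i \<notin> S \<Longrightarrow> (s i)\<^sup>2 = 1 / (2 * q)"
    and pq: "0 < q" "q \<le> p" and S: "S \<noteq> {}" "- S \<noteq> {}"
    and a: "a = real DIM('k) * real (card S) / 2" and b: "b = real DIM('k) * real (card (- S)) / 2"
  shows "has_largest_lyapunov_exponent M X (1 / 2 * (Digamma (a + b) - ln q +
    Gamma (a + b) / (Gamma a * Gamma b) *
      (LBINT x:{0..1}. x powr (a - 1) * (1 - x) powr (b - 1) * ln (1 - (1 - q / p) * x))))"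
proof -
  interpret M: prob_space M by fact
  interpret M': prob_space M' by fact
  let ?w = "\<lambda>u. u / p + (1 - u) / q"
  define e where "e = (\<integral>u. beta_density a b u * ln (?w u) \<partial>lborel)"
  define L where "L = \<bar>ln p\<bar> + \<bar>ln q\<bar>"
  define J where "J t = (\<integral>\<^sup>+u. ennreal (beta_density a b u * ?w u powr t) \<partial>lborel)" for t
  define \<kappa> where "\<kappa> t = ennreal (Gamma (a + b + t / 2) / Gamma (a + b)) * J (t / 2)" for t
  define U where "U t = Gamma (a + b + t / 2) / Gamma (a + b) * (1 + t / 2 * e + (t / 2)\<^sup>2 * L\<^sup>2)" for t
  \<comment> \<open>The bound \<open>a + b\<close> keeps the Gamma argument positive,
    \<open>1 / (L + 1)\<close> keeps \<open>t / 2 * ln (?w u)\<close> in the range of the quadratic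
    estimate; the added 1 covers \<open>L = 0\<close>.\<close>
  define \<delta> where "\<delta> = min (a + b) (1 / (L + 1))"
  have ab: "0 < a" "0 < b" using S by (auto simp: a b card_gt_0_iff)
  have p: "0 < p" using pq by simp
  have L: "0 \<le> L" by (simp add: L_def)
  have \<delta>: "0 < \<delta>" using ab L by (simp add: \<delta>_def)
  have small: "0 < a + b + t / 2" "\<bar>t / 2\<bar> * L \<le> 1" if "\<bar>t\<bar> < \<delta>" for t
  proof -
    show "0 < a + b + t / 2" using that ab unfolding \<delta>_def by auto
    have "\<bar>t / 2\<bar> * L \<le> 1 / (L + 1) * L"
      using that L unfolding \<delta>_def by (intro mult_right_mono) auto
    also have "\<dots> \<le> 1" using L by simp
    finally show "\<bar>t / 2\<bar> * L \<le> 1" .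
  qed
  have w: "0 < ?w u \<and> \<bar>ln (?w u)\<bar> \<le> L" if "0 < u" "u < 1" for u
    unfolding L_def by (rule beta_density_expectation_ln(2)[OF ab pq that])
  have G': "(\<lambda>\<omega>. diag_mat s ** G \<omega>) \<in> borel_measurable M'"
    using M'.std_gaussian_matrix_measurable[OF G] by measurable
  have ind: "M.indep_vars (\<lambda>_. borel) X {1..}" and law: "\<And>m. 1 \<le> m \<Longrightarrow> distr M borel (X m) = distr M' borel (\<lambda>\<omega>. diag_mat s ** G \<omega>)"
    using X by (auto simp: iid_copies_def)
  have step: "(\<integral>\<^sup>+\<omega>. ennreal (norm (X m \<omega> *v v) powr t) \<partial>M) = \<kappa> t * ennreal (norm v powr t)"
    if "1 \<le> m" "\<bar>t\<bar> < \<delta>" for m v t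
  proof -
    have Xm: "X m \<in> borel_measurable M" using ind that unfolding M.indep_vars_def by auto
    have "(\<integral>\<^sup>+\<omega>. ennreal (norm (X m \<omega> *v v) powr t) \<partial>M) = (\<integral>\<^sup>+A. ennreal (norm (A *v v) powr t) \<partial>distr M borel (X m))"
      using Xm by (subst nn_integral_distr) auto
    also have "\<dots> = (\<integral>\<^sup>+\<omega>. ennreal (norm ((diag_mat s ** G \<omega>) *v v) powr t) \<partial>M')"
      unfolding law[OF that(1)] using G' by (subst nn_integral_distr) auto
    also have "\<dots> = \<kappa> t * ennreal (norm v powr t)"
      unfolding \<kappa>_def J_def
      by (rule M'.nn_integral_norm_diag_gaussian_powr[OF G s p pq(1) S a b small(1)[OF that(2)]])
    finally show ?thesis .
  qed
  have J0: "J 0 = 1"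
  proof -
    have "J 0 = (\<integral>\<^sup>+u. ennreal (beta_density a b u) \<partial>lborel)"
      unfolding J_def
    proof (rule nn_integral_cong)
      fix u
      \<comment> \<open>As \<open>0 powr 0 = 0\<close>, this uses that \<open>?w u\<close> is
        positive on the support of the density.\<close>
      show "ennreal (beta_density a b u * ?w u powr 0) = ennreal (beta_density a b u)"
        using w[of u] by (cases "0 < u \<and> u < 1") (auto simp: beta_density_def)
    qed
    then show ?thesis by (simp add: beta_density_integral(3)[OF ab])
  qed
  have "Gamma (a + b) \<noteq> 0" using Gamma_real_pos[of "a + b"] ab by linarith
  then have \<kappa>0: "\<kappa> 0 = 1" and U0: "U 0 = 1" by (simp_all add: \<kappa>_def U_def J0)
  have \<kappa>U: "\<kappa> t \<le> ennreal (U t)" if "\<bar>t\<bar> < \<delta>" for t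
  proof -
    have g: "0 \<le> Gamma (a + b + t / 2) / Gamma (a + b)"
      using small(1)[OF that] ab by (intro divide_nonneg_pos less_imp_le Gamma_real_pos) auto
    have "J (t / 2) \<le> ennreal (1 + t / 2 * e + (t / 2)\<^sup>2 * L\<^sup>2)"
      unfolding J_def e_def
      by (rule beta_density_expectation_powr_le(2)[OF ab _ w small(2)[OF that]]) measurable
    then show ?thesis
      unfolding \<kappa>_def U_def ennreal_mult'[OF g] by (rule mult_left_mono) simp
  qed
  have "(U has_real_derivative (1 / 2 * (Digamma (a + b) + e))) (at 0)"
    unfolding U_def[abs_def] using ab by (intro has_real_derivative_Gamma_quotient) auto
  from M.has_largest_lyapunov_exponentI[OF ind step \<kappa>0 \<kappa>U U0 this \<delta>]
  show ?thesis
    using beta_density_expectation_ln(1)[OF ab pq] by (simp add: e_def algebra_simps)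
qed

theorem proposition7:
  fixes M :: "'w measure" and M' :: "'v measure"
    and b\<^sub>1 b\<^sub>2 :: real and N N\<^sub>0 :: nat
    and \<sigma> :: "'n::finite \<Rightarrow> real" and pos :: "'n \<Rightarrow> nat"
  assumes M: "prob_space M" and M': "prob_space M'"
    and N: "N = CARD('n)" and N0: "1 \<le> N\<^sub>0" "N\<^sub>0 \<le> N - 1"
    and b: "0 < b\<^sub>2" "b\<^sub>2 \<le> b\<^sub>1"
    and pos: "bij_betw pos UNIV {1..N}"
    and \<sigma>1: "\<And>i. pos i \<le> N\<^sub>0 \<Longrightarrow> 1 / (2 * (\<sigma> i)\<^sup>2) = b\<^sub>1"
    and \<sigma>2: "\<And>i. N\<^sub>0 < pos i \<Longrightarrow> 1 / (2 * (\<sigma> i)\<^sup>2) = b\<^sub>2"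
  shows
    "let \<mu> = (\<lambda>\<beta>::real. 1 / 2 *
          (Digamma (\<beta> * N / 2) - ln b\<^sub>2
           + Gamma (\<beta> * N / 2) / (Gamma (\<beta> * N\<^sub>0 / 2) * Gamma (\<beta> * (real N - real N\<^sub>0) / 2))
             * (LBINT x:{0..1}. x powr (\<beta> * N\<^sub>0 / 2 - 1) * (1 - x) powr (\<beta> * (real N - real N\<^sub>0) / 2 - 1)
                  * ln (1 - (1 - b\<^sub>2 / b\<^sub>1) * x))));
         s = (\<lambda>i. sqrt ((\<sigma> i)\<^sup>2))
     in (\<forall>(G :: 'v \<Rightarrow> real ^ 'n ^ 'n) (X :: nat \<Rightarrow> 'w \<Rightarrow> real ^ 'n ^ 'n).
            std_gaussian_matrix M' G \<longrightarrow> iid_copies M X M' (\<lambda>\<omega>. diag_mat s ** G \<omega>)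
            \<longrightarrow> has_largest_lyapunov_exponent M X (\<mu> 1)) \<and>
        (\<forall>(G :: 'v \<Rightarrow> complex ^ 'n ^ 'n) (X :: nat \<Rightarrow> 'w \<Rightarrow> complex ^ 'n ^ 'n).
            std_gaussian_matrix M' G \<longrightarrow> iid_copies M X M' (\<lambda>\<omega>. diag_mat s ** G \<omega>)
            \<longrightarrow> has_largest_lyapunov_exponent M X (\<mu> 2)) \<and>
        (\<forall>(G :: 'v \<Rightarrow> quat ^ 'n ^ 'n) (X :: nat \<Rightarrow> 'w \<Rightarrow> quat ^ 'n ^ 'n).
            std_gaussian_matrix M' G \<longrightarrow> iid_copies M X M' (\<lambda>\<omega>. diag_mat s ** G \<omega>)
            \<longrightarrow> has_largest_lyapunov_exponent M X (\<mu> 4))"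
proof -
  \<comment> \<open>The numbering \<open>pos\<close> serves only to single out the first block and
    to count it.\<close>
  define S where "S = {i. pos i \<le> N\<^sub>0}"
  have bij: "inj pos" "range pos = {1..N}" using pos by (auto simp: bij_betw_def)
  have "pos ` S = {1..N\<^sub>0}"
  proof (intro equalityI subsetI)
    fix k assume k: "k \<in> {1..N\<^sub>0}"
    then have "k \<in> range pos" using bij(2) N0 by auto
    then show "k \<in> pos ` S" using k by (auto simp: S_def)
  qed (use bij in \<open>auto simp: S_def\<close>)
  then have cS: "card S = N\<^sub>0"
    using card_image[of pos S] inj_on_subset[OF bij(1)] by simp
  then have cS': "card (- S) = N - N\<^sub>0" by (simp add: Compl_eq_Diff_UNIV card_Diff_subset N)
  have S: "S \<noteq> {}" "- S \<noteq> {}" using cS cS' N0 by auto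
  have p: "0 < b\<^sub>1" using b by simp
  \<comment> \<open>Positivity of \<open>c\<close> excludes \<open>x = 0\<close>, where the division
    would return 0.\<close>
  have inv: "x = 1 / (2 * c)" if "1 / (2 * x) = c" "0 < c" for x c :: real
    using that by (auto simp: field_simps)
  have sq: "(sqrt ((\<sigma> i)\<^sup>2))\<^sup>2 = (\<sigma> i)\<^sup>2" for i by simp
  have s: "(sqrt ((\<sigma> i)\<^sup>2))\<^sup>2 = 1 / (2 * b\<^sub>1)" if "i \<in> S" for i
    using inv[OF \<sigma>1 p, of i] that by (simp only: sq) (simp add: S_def)
  have s': "(sqrt ((\<sigma> i)\<^sup>2))\<^sup>2 = 1 / (2 * b\<^sub>2)" if "i \<notin> S" for i
    using inv[OF \<sigma>2 b(1), of i] that by (simp only: sq) (simp add: S_def)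
  have N0': "N\<^sub>0 \<le> N" using N0 by simp
  have ab: "\<beta> * real N\<^sub>0 / 2 + \<beta> * (real N - real N\<^sub>0) / 2 = \<beta> * real N / 2" for \<beta> :: real
    by (simp add: algebra_simps flip: add_divide_distrib)
  note main = gaussian_product_largest_lyapunov_exponent[OF M M' _ _ s s' b S,
      where a="\<beta> * N\<^sub>0 / 2" and b="\<beta> * (real N - real N\<^sub>0) / 2" for \<beta> :: real, unfolded ab]
  \<comment> \<open>What remains is to match the shape parameters: the dimensions 1, 2 and 4 times
    the two block sizes, with \<open>N - N\<^sub>0\<close> read as a real difference.\<close>
  show ?thesis
    unfolding Let_def
    by (intro conjI allI impI main) (use cS cS' N0' in \<open>auto simp: of_nat_diff\<close>)
qed

end
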